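(* Assume the model is symmetric, i.e. $\lambda_i=\lambda$ and $|V_i|=V$ for all $i=1,\dots,K$. (i) If $\lambda<e^{-1}/V$, then the Markov chain $W=(W(n))_{n\ge 0}$ is positive recurrent. (ii) Assume, in addition to $\lambda<e^{-1}/V$, that $\mathsf P(A_1(1)=A_2(1)=\dots=A_K(1)=0)>0$. Then $W$ is ergodic, i.e. there exists a unique stationary distribution and, for every initial state, the distribution of $W(n)$ converges to the stationary one in the total variation norm.
   Context: Model. $\mathcal G=(\mathcal V,\mathcal E)$ is a connected undirected graph with finite vertex set $\mathcal V=\{1,\dots,K\}$. For $i\in\mathcal V$, $V_i=\{i\}\cup\{j\in\mathcal V:(i,j)\in\mathcal E\}$ is the closed neighbourhood of $i$, and $|V_i|$ is its cardinality. Time is slotted, $n=0,1,2,\dots$. The arrival vectors $A(n)=(A_1(n),\dots,A_K(n))\in\mathbb N^K$ (with $\mathbb N=\{0,1,2,\dots\}$) form an i.i.d. sequence in $n$ (the coordinates of one vector may be dependent), with $\mathbf E A_i(n)=\lambda_i\in(0,\infty)$. $W_i(n)$ is the number of users at vertex $i$ at time $n$. At time $n$ each user at vertex $i$ attempts transmission, independently of all others, with probability $1/\sum_{j\in V_i}W_j(n)$; the user is served and leaves iff it is the only user in $V_i$ attempting transmission. Thus, given $W(n)$, the numbers $N_i(n)$ of attempting users at the vertices $i=1,\dots,K$ are independent, $N_i(n)$ being binomial with parameters $\bigl(W_i(n),1/\sum_{j\in V_i}W_j(n)\bigr)$ (and $N_i(n)=0$ if $W_i(n)=0$), and $$W_i(n)=W_i(n-1)+A_i(n)-\mathbf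 1\{N_i(n-1)=1\}\prod_{j\in V_i\setminus\{i\}}\mathbf 1\{N_j(n-1)=0\}.$$ $W=(W(n))$ is a time-homogeneous Markov chain on $\mathbb N^K$, taken to be irreducible. *)

theory Defs
  imports "HOL-Probability.Probability"
begin

text \<open>
  Markov chains on a countable state space are given by their transition kernel
  \<open>P :: 's \<Rightarrow> 's pmf\<close>; \<open>P x\<close> is the law of the next state when the present state is \<open>x\<close>.
\<close>

text \<open>Law of \<open>X(n)\<close> for the chain \<open>X\<close> started at \<open>X(0) = x\<close>.\<close>

primrec step_law :: "('s \<Rightarrow> 's pmf) \<Rightarrow> 's \<Rightarrow> nat \<Rightarrow> 's pmf" where
  "step_law P x 0 = return_pmf x"
| "step_law P x (Suc n) = bind_pmf (step_law P x n) P"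

text \<open>Joint law of \<open>[X(0), \<dots>, X(n)]\<close> for the chain \<open>X\<close> started at \<open>X(0) = x\<close>.\<close>

primrec path_law :: "('s \<Rightarrow> 's pmf) \<Rightarrow> 's \<Rightarrow> nat \<Rightarrow> 's list pmf" where
  "path_law P x 0 = return_pmf [x]"
| "path_law P x (Suc n) =
     bind_pmf (path_law P x n) (\<lambda>xs. map_pmf (\<lambda>y. xs @ [y]) (P (last xs)))"

lemma length_path_law: "xs \<in> set_pmf (path_law P x n) \<Longrightarrow> length xs = Suc n"
  by (induction n arbitrary: xs) auto

lemma map_last_path_law: "map_pmf last (path_law P x n) = step_law P x n"
proof (induction n)
  case (Suc n)
  have "map_pmf last (path_law P x (Suc n)) = bind_pmf (path_law P x n) (\<lambda>xs. P (last xs))"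
    by (simp add: map_bind_pmf pmf.map_comp o_def)
  also have "\<dots> = bind_pmf (map_pmf last (path_law P x n)) P"
    by (simp add: bind_map_pmf)
  finally show ?case
    by (simp add: Suc.IH)
qed simp

definition irreducible_chain :: "('s \<Rightarrow> 's pmf) \<Rightarrow> bool" where
  "irreducible_chain P \<longleftrightarrow> (\<forall>x y. \<exists>n. pmf (step_law P x n) y > 0)"

text \<open>
  The probability that the first return time \<open>min {n \<ge> 1. X(n) = x}\<close> of the chain
  started at \<open>x\<close> is equal to \<open>n\<close>, for \<open>n \<ge> 1\<close>.
\<close>

definition first_return_prob :: "('s \<Rightarrow> 's pmf) \<Rightarrow> 's \<Rightarrow> nat \<Rightarrow> real" where
  "first_return_prob P x n =
     measure_pmf.prob (path_law P x n) {xs. xs ! n = x \<and> (\<forall>k\<in>{1..<n}. xs ! k \<noteq> x)}"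

text \<open>
  The return time is almost surely finite and has finite expectation. The series are
  shifted by one because return times are at least one.
\<close>

definition positive_recurrent_state :: "('s \<Rightarrow> 's pmf) \<Rightarrow> 's \<Rightarrow> bool" where
  "positive_recurrent_state P x \<longleftrightarrow>
     (\<lambda>n. first_return_prob P x (Suc n)) sums 1 \<and>
     summable (\<lambda>n. real (Suc n) * first_return_prob P x (Suc n))"

definition positive_recurrent_chain :: "('s \<Rightarrow> 's pmf) \<Rightarrow> bool" where
  "positive_recurrent_chain P \<longleftrightarrow> (\<forall>x. positive_recurrent_state P x)"

definition stationary :: "('s \<Rightarrow> 's pmf) \<Rightarrow> 's pmf \<Rightarrow> bool" where
  "stationary P \<pi> \<longleftrightarrow> bind_pmf \<pi> P = \<pi>"

definition tv_dist :: "'s pmf \<Rightarrow> 's pmf \<Rightarrow> real" where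
  "tv_dist p q = (SUP B. \<bar>measure_pmf.prob p B - measure_pmf.prob q B\<bar>)"

definition ergodic_chain :: "('s \<Rightarrow> 's pmf) \<Rightarrow> bool" where
  "ergodic_chain P \<longleftrightarrow>
     (\<exists>\<pi>. stationary P \<pi> \<and> (\<forall>\<pi>'. stationary P \<pi>' \<longrightarrow> \<pi>' = \<pi>) \<and>
          (\<forall>x. (\<lambda>n. tv_dist (step_law P x n) \<pi>) \<longlonglongrightarrow> 0))"

text \<open>
  The vertices are the elements of a finite type \<open>'v\<close> and \<open>E\<close> is the (symmetric) edge
  relation. The set \<open>nbhd E i\<close> is the closed neighbourhood, so loops in \<open>E\<close> are irrelevant.
\<close>

definition connected_graph :: "'v rel \<Rightarrow> bool" where
  "connected_graph E \<longleftrightarrow> sym E \<and> (\<forall>i j. (i, j) \<in> E\<^sup>*)"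

definition nbhd :: "'v rel \<Rightarrow> 'v \<Rightarrow> 'v set" where
  "nbhd E i = insert i {j. (i, j) \<in> E}"

text \<open>
  Joint law of the numbers of attempting users in state \<open>w\<close>. If the population of
  \<open>nbhd E i\<close> is zero, then the success probability is \<open>1 / 0 = 0\<close> and \<open>w i = 0\<close>, so the
  number of attempts at \<open>i\<close> is zero.
\<close>

definition attempts :: "'v::finite rel \<Rightarrow> ('v \<Rightarrow> nat) \<Rightarrow> ('v \<Rightarrow> nat) pmf" where
  "attempts E w =
     Pi_pmf UNIV 0 (\<lambda>i. binomial_pmf (w i) (1 / real (\<Sum>j\<in>nbhd E i. w j)))"

definition departures :: "'v::finite rel \<Rightarrow> ('v \<Rightarrow> nat) \<Rightarrow> 'v \<Rightarrow> nat" where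
  "departures E m i = of_bool (m i = 1) * (\<Prod>j\<in>nbhd E i - {i}. of_bool (m j = 0))"

text \<open>
  Transition kernel of \<open>W\<close>, where \<open>\<alpha>\<close> is the common law of the i.i.d. arrival vectors. The
  subtraction on \<^typ>\<open>nat\<close> does not truncate: a departure from \<open>i\<close> needs an attempt
  at \<open>i\<close>, hence \<open>w i \<ge> 1\<close>.
\<close>

definition queue_kernel ::
  "'v::finite rel \<Rightarrow> ('v \<Rightarrow> nat) pmf \<Rightarrow> ('v \<Rightarrow> nat) \<Rightarrow> ('v \<Rightarrow> nat) pmf" where
  "queue_kernel E \<alpha> w =
     bind_pmf (attempts E w)
       (\<lambda>m. map_pmf (\<lambda>a i. w i + a i - departures E m i) \<alpha>)"

end

theory Submission
  imports Defs
begin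

text \<open>
  With \<open>x j = w j / (\<Sum>k\<in>nbhd E j. w k)\<close>, the service rate at \<open>i\<close> in a large state \<open>w\<close> is close to
  \<open>x i * exp (- (\<Sum>j\<in>nbhd E i. x j))\<close>. This is the proportionally fair allocation, so by concavity of
  the logarithm \<open>\<Sum>i. w i * rate i\<close> is, up to a constant, at least what one obtains from the uniform
  attempt probability \<open>1 / V\<close>, namely \<open>exp (-1) / V * (\<Sum>i. w i)\<close>. Therefore the Euclidean norm of
  the state has a uniformly negative drift outside a finite set if \<open>lam < exp (-1) / V\<close>. The norm
  is Lipschitz, so first moments of the arrivals suffice, and Foster's criterion yields positive
  recurrence. If arrivals can vanish, the empty state has a self-loop, and two independent copies
  of the chain meet there almost surely.
\<close>

section \<open>Expectations under probability mass functions\<close>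

text \<open>The threshold is the approximate rate for the constant attempt probability
  \<open>p = 1 / V\<close>: a closed neighbourhood has \<open>V\<close> vertices, and
  \<open>p * exp (- V * p) = exp (-1) / V\<close>. A single coordinate may well grow on average,
  since its own rate can lie far below \<open>lam\<close>; only the sum weighted with
  \<open>w i\<close> is under control, and these weights are half the gradient of the squared norm.
  The squared norm itself would ask for second moments of the arrivals. Dividing the weighted drift
  by the norm keeps it away from zero because the sum of the entries dominates the norm.

  Recurrence, the stationary law and the coupling all go through the probability of avoiding a state
  up to time \<open>n\<close>. Its sum over \<open>n\<close> is a mean hitting time; for the product
  chain, invariance of the product of stationary laws takes the place of a drift condition.\<close>

lemma integrable_measure_pmf_bounded:
  fixes g :: "'a \<Rightarrow> real"
  assumes "\<And>y. \<bar>g y\<bar> \<le> B"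
  shows "integrable (measure_pmf p) g"
  by (rule measure_pmf.integrable_const_bound[where B = B]) (use assms in auto)

lemma integral_bind_pmf_bounded:
  fixes g :: "'b \<Rightarrow> real"
  assumes "\<And>y. \<bar>g y\<bar> \<le> B"
  shows "measure_pmf.expectation (bind_pmf p K) g =
           measure_pmf.expectation p (\<lambda>x. measure_pmf.expectation (K x) g)"
  unfolding measure_pmf_bind
  by (rule integral_bind[where K = "count_space UNIV" and B = B and B' = 1])
    (use assms in \<open>auto intro: measure_pmf_in_subprob_algebra\<close>)

lemma measure_bind_pmf:
  "measure_pmf.prob (bind_pmf p K) A = measure_pmf.expectation p (\<lambda>x. measure_pmf.prob (K x) A)"
  using integral_bind_pmf_bounded[of "indicator A" 1 p K]
  by (simp add: indicator_def)

lemma pmf_mult_le_expectation: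
  fixes g :: "'a \<Rightarrow> real"
  assumes "\<And>y. 0 \<le> g y" "\<And>y. g y \<le> B"
  shows "pmf p y * g y \<le> measure_pmf.expectation p g"
proof -
  have int: "integrable (measure_pmf p) h" if "\<And>x. \<bar>h x\<bar> \<le> B" for h :: "'a \<Rightarrow> real"
    by (rule integrable_measure_pmf_bounded[OF that])
  have "pmf p y * g y = measure_pmf.expectation p (\<lambda>x. indicator {y} x * g y)"
    by (simp add: measure_pmf_single)
  also have "\<dots> \<le> measure_pmf.expectation p g"
  proof (rule integral_mono)
    show "integrable (measure_pmf p) (\<lambda>x. indicator {y} x * g y)"
      by (rule int) (use assms order_trans[OF assms(1) assms(2)] in \<open>auto simp: indicator_def\<close>)
    show "integrable (measure_pmf p) g"
      by (rule int) (use assms in auto)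
  qed (use assms in \<open>auto simp: indicator_def\<close>)
  finally show ?thesis .
qed

section \<open>Avoiding a state\<close>

text \<open>\<open>path_law\<close> appends new states at the end, whereas first-step analysis
  splits off the first transition.\<close>

lemma path_law_Suc_first:
  "path_law P y (Suc n) = bind_pmf (P y) (\<lambda>z. map_pmf ((#) y) (path_law P z n))"
proof (induction n)
  case 0
  show ?case
    by (simp add: bind_return_pmf map_pmf_def)
next
  case (Suc n)
  let ?G = "\<lambda>xs. map_pmf (\<lambda>v. xs @ [v]) (P (last xs))"
  have "path_law P y (Suc (Suc n)) =
      bind_pmf (bind_pmf (P y) (\<lambda>z. map_pmf ((#) y) (path_law P z n))) ?G"
    by (simp only: path_law.simps(2)[of P y "Suc n"] Suc.IH)
  also have "\<dots> = bind_pmf (P y) (\<lambda>z. bind_pmf (path_law P z n) (\<lambda>xs. ?G (y # xs)))"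
    by (simp add: bind_assoc_pmf bind_map_pmf)
  also have "\<dots> = bind_pmf (P y) (\<lambda>z. map_pmf ((#) y) (path_law P z (Suc n)))"
  proof (intro bind_pmf_cong refl)
    fix z
    \<comment> \<open>Paths are nonempty, so prepending \<open>y\<close> does not change the last
      state.\<close>
    have "?G (y # xs) = map_pmf ((#) y) (?G xs)" if "xs \<in> set_pmf (path_law P z n)" for xs
      using length_path_law[OF that] by (auto simp: pmf.map_comp o_def)
    then show "bind_pmf (path_law P z n) (\<lambda>xs. ?G (y # xs)) =
        map_pmf ((#) y) (path_law P z (Suc n))"
      by (simp add: map_bind_pmf cong: bind_pmf_cong)
  qed
  finally show ?case .
qed

lemma step_law_Suc_first:
  "step_law P y (Suc n) = bind_pmf (P y) (\<lambda>z. step_law P z n)"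
  by (induction n) (simp_all add: bind_return_pmf bind_return_pmf' bind_assoc_pmf)

lemma step_law_add:
  "step_law P x (m + n) = bind_pmf (step_law P x m) (\<lambda>y. step_law P y n)"
  by (induction n) (simp_all add: bind_return_pmf' bind_assoc_pmf)

lemma set_step_law_add:
  assumes "y \<in> set_pmf (step_law P x m)" "z \<in> set_pmf (step_law P y n)"
  shows "z \<in> set_pmf (step_law P x (m + n))"
  using assms by (auto simp: step_law_add)

text \<open>Time 0 is not inspected, so for \<open>y = x\<close> this is the tail of the first
  return time.\<close>

definition avoid_prob :: "('s \<Rightarrow> 's pmf) \<Rightarrow> 's \<Rightarrow> nat \<Rightarrow> 's \<Rightarrow> real" where
  "avoid_prob P x n y = measure_pmf.prob (path_law P y n) {xs. \<forall>k\<in>{1..n}. xs ! k \<noteq> x}"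

lemma avoid_prob_0 [simp]: "avoid_prob P x 0 y = 1"
  by (simp add: avoid_prob_def)

lemma avoid_prob_nonneg [simp]: "0 \<le> avoid_prob P x n y"
  and avoid_prob_le_1 [simp]: "avoid_prob P x n y \<le> 1"
  by (simp_all add: avoid_prob_def)

text \<open>First-step equation: \<open>avoid_prob P x n\<close> is the \<open>n\<close>-th iterate
  of the kernel killed on entering \<open>x\<close>, applied to the constant 1.\<close>

lemma avoid_prob_Suc:
  "avoid_prob P x (Suc n) y =
     measure_pmf.expectation (P y) (\<lambda>z. of_bool (z \<noteq> x) * avoid_prob P x n z)"
proof -
  have "measure_pmf.prob (map_pmf ((#) y) (path_law P z n)) {xs. \<forall>k\<in>{1..Suc n}. xs ! k \<noteq> x} =
      of_bool (z \<noteq> x) * avoid_prob P x n z" for z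
  proof -
    have hd: "xs ! 0 = z" if "xs \<in> set_pmf (path_law P z n)" for xs
      using that by (cases n) (auto simp del: path_law.simps(2) simp: path_law_Suc_first)
    have "(\<forall>k\<in>{1..Suc n}. (y # xs) ! k \<noteq> x) \<longleftrightarrow> (\<forall>k\<in>{0..n}. xs ! k \<noteq> x)" for xs
      by (simp add: image_Suc_atLeastAtMost[of 0 n, symmetric] del: image_Suc_atLeastAtMost)
    also have "(\<forall>k\<in>{0..n}. xs ! k \<noteq> x) \<longleftrightarrow> xs ! 0 \<noteq> x \<and> (\<forall>k\<in>{1..n}. xs ! k \<noteq> x)" for xs
      by (subst atLeastAtMost_insertL[of 0 n, symmetric]) auto
    finally have eq: "(\<forall>k\<in>{1..Suc n}. (y # xs) ! k \<noteq> x) \<longleftrightarrow>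
        xs ! 0 \<noteq> x \<and> (\<forall>k\<in>{1..n}. xs ! k \<noteq> x)" for xs .
    have "measure_pmf.prob (map_pmf ((#) y) (path_law P z n)) {xs. \<forall>k\<in>{1..Suc n}. xs ! k \<noteq> x} =
        measure_pmf.prob (path_law P z n) {xs. xs ! 0 \<noteq> x \<and> (\<forall>k\<in>{1..n}. xs ! k \<noteq> x)}"
      unfolding measure_map_pmf vimage_def mem_Collect_eq eq ..
    also have "\<dots> = measure_pmf.prob (path_law P z n)
        (if z \<noteq> x then {xs. \<forall>k\<in>{1..n}. xs ! k \<noteq> x} else {})"
      by (rule measure_pmf.finite_measure_eq_AE) (auto intro!: AE_pmfI simp: hd)
    also have "\<dots> = of_bool (z \<noteq> x) * avoid_prob P x n z"
      by (simp add: avoid_prob_def)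
    finally show ?thesis .
  qed
  then show ?thesis
    unfolding avoid_prob_def[of P x "Suc n"] path_law_Suc_first measure_bind_pmf by simp
qed

text \<open>A return at time \<open>Suc n\<close> is the difference of two tail events;
  \<open>butlast\<close> brings both onto the same path space.\<close>

lemma first_return_prob_Suc:
  "first_return_prob P x (Suc n) = avoid_prob P x n x - avoid_prob P x (Suc n) x"
proof -
  let ?A = "\<lambda>m. {xs. \<forall>k\<in>{1..m}. xs ! k \<noteq> x}"
  let ?M = "measure_pmf.prob (path_law P x (Suc n))"
  have "path_law P x n = map_pmf butlast (path_law P x (Suc n))"
    by (simp add: map_bind_pmf pmf.map_comp o_def bind_return_pmf')
  then have "avoid_prob P x n x = ?M (butlast -` ?A n)"
    unfolding avoid_prob_def by (simp only: measure_map_pmf)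
  also have "\<dots> = ?M (?A n)"
    by (rule measure_pmf.finite_measure_eq_AE)
      (auto intro!: AE_pmfI dest!: length_path_law simp: nth_butlast simp del: path_law.simps)
  finally have "avoid_prob P x n x - avoid_prob P x (Suc n) x = ?M (?A n - ?A (Suc n))"
    unfolding avoid_prob_def by (subst measure_pmf.finite_measure_Diff) auto
  also have "?A n - ?A (Suc n) = {xs. xs ! Suc n = x \<and> (\<forall>k\<in>{1..<Suc n}. xs ! k \<noteq> x)}"
    unfolding atLeastLessThanSuc_atLeastAtMost by (auto simp: atLeastAtMostSuc_conv)
  finally show ?thesis
    by (simp add: first_return_prob_def)
qed

lemma avoid_prob_le_step_law:
  assumes "0 < n"
  shows "avoid_prob P x n y \<le> 1 - pmf (step_law P y n) x"
proof -
  have "avoid_prob P x n y \<le> measure_pmf.prob (path_law P y n) (last -` (- {x}))"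
    unfolding avoid_prob_def
  proof (rule measure_pmf.finite_measure_mono_AE)
    have last: "xs ! n = last xs" if "xs \<in> set_pmf (path_law P y n)" for xs
      using length_path_law[OF that] by (subst last_conv_nth) auto
    then show "AE xs in path_law P y n. xs \<in> {xs. \<forall>k\<in>{1..n}. xs ! k \<noteq> x} \<longrightarrow>
        xs \<in> last -` (- {x})"
      using assms by (force intro!: AE_pmfI dest!: last)
  qed auto
  also have "\<dots> = measure_pmf.prob (step_law P y n) (- {x})"
    by (subst map_last_path_law[symmetric]) simp
  also have "\<dots> = 1 - pmf (step_law P y n) x"
    using measure_pmf.prob_compl[of "{x}" "step_law P y n"]
    by (simp add: measure_pmf_single Compl_eq_Diff_UNIV)
  finally show ?thesis .
qed

lemma decseq_avoid_prob: "decseq (\<lambda>n. avoid_prob P x n y)"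
proof (rule decseq_SucI)
  fix n
  show "avoid_prob P x (Suc n) y \<le> avoid_prob P x n y"
  proof (induction n arbitrary: y)
    case (Suc n)
    have "measure_pmf.expectation (P y) (\<lambda>z. of_bool (z \<noteq> x) * avoid_prob P x (Suc n) z) \<le>
        measure_pmf.expectation (P y) (\<lambda>z. of_bool (z \<noteq> x) * avoid_prob P x n z)"
      by (intro integral_mono mult_left_mono Suc.IH integrable_measure_pmf_bounded[where B = 1])
        (auto split: split_of_bool)
    then show ?case
      by (simp only: avoid_prob_Suc[of P x "Suc n" y] avoid_prob_Suc[of P x n y])
  qed simp
qed

text \<open>The mean of an integer time is the sum of its tails. Summable tails also tend to zero,
  so the return time is almost surely finite.\<close>

lemma positive_recurrent_stateI:
  assumes sm: "summable (\<lambda>n. avoid_prob P x n x)"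
  shows "positive_recurrent_state P x"
proof -
  let ?u = "\<lambda>n. avoid_prob P x n x" and ?f = "\<lambda>n. first_return_prob P x (Suc n)"
  \<comment> \<open>Summation by parts. The boundary term is nonpositive and is dropped from the
    upper bound.\<close>
  have part: "(\<Sum>n<N. real (Suc n) * ?f n) = (\<Sum>n<N. ?u n) - real N * ?u N" for N
    by (induction N) (simp_all add: first_return_prob_Suc algebra_simps)
  have "(\<lambda>n. ?u n - ?u (Suc n)) sums (?u 0 - 0)"
    by (rule telescope_sums'[OF summable_LIMSEQ_zero[OF sm]])
  moreover have "summable (\<lambda>n. real (Suc n) * ?f n)"
  proof (rule bounded_imp_summable)
    fix N
    have "(\<Sum>n\<le>N. real (Suc n) * ?f n) \<le> (\<Sum>n<Suc N. ?u n)"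
      unfolding lessThan_Suc_atMost[symmetric] part by simp
    also have "\<dots> \<le> suminf ?u"
      by (rule sum_le_suminf[OF sm]) auto
    finally show "(\<Sum>n\<le>N. real (Suc n) * ?f n) \<le> suminf ?u" .
  qed (simp add: first_return_prob_def)
  ultimately show ?thesis
    by (simp add: positive_recurrent_state_def first_return_prob_Suc)
qed


section \<open>Foster's criterion\<close>

text \<open>
  The expected time of avoiding \<open>x\<close> up to a large horizon is a correction term that turns the
  drift condition outside of a finite set into one that holds everywhere for the chain killed at \<open>x\<close>.
\<close>

theorem foster_summable_avoid_prob:
  fixes P :: "'s \<Rightarrow> 's pmf" and f :: "'s \<Rightarrow> real"
  assumes irr: "irreducible_chain P" and fin: "finite F" and "\<epsilon> > 0"
    and f_nonneg: "\<And>y. 0 \<le> f y" and f_int: "\<And>y. integrable (measure_pmf (P y)) f"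
    and drift: "\<And>y. y \<notin> F \<Longrightarrow> measure_pmf.expectation (P y) f \<le> f y - \<epsilon>"
  shows "summable (\<lambda>n. avoid_prob P x n y)"
proof -
  let ?u = "avoid_prob P x"
  define Q where "Q g z = measure_pmf.expectation (P z) (\<lambda>v. of_bool (v \<noteq> x) * g v)"
    for g :: "'s \<Rightarrow> real" and z
  have int_u: "integrable (measure_pmf (P z)) (\<lambda>v. of_bool (v \<noteq> x) * ?u n v)" for n z
    by (rule integrable_measure_pmf_bounded[where B = 1]) (auto split: split_of_bool)
  have int_f: "integrable (measure_pmf (P z)) (\<lambda>v. of_bool (v \<noteq> x) * f v)" for z
    by (rule Bochner_Integration.integrable_bound[OF f_int[of z]]) (auto split: split_of_bool)

  have "\<exists>n. ?u n z < 1" for z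
  proof -
    \<comment> \<open>Going through a successor of \<open>z\<close> makes the number of steps
      positive, which matters when \<open>z = x\<close>.\<close>
    obtain v where v: "v \<in> set_pmf (P z)"
      using set_pmf_not_empty by fast
    obtain n where "x \<in> set_pmf (step_law P v n)"
      using irr unfolding irreducible_chain_def by (metis pmf_positive_iff)
    with v have "pmf (step_law P z (Suc n)) x > 0"
      by (auto simp: step_law_Suc_first pmf_positive_iff simp del: step_law.simps)
    then have "?u (Suc n) z < 1"
      using avoid_prob_le_step_law[of "Suc n" P x z] by linarith
    then show ?thesis ..
  qed
  then obtain m where m: "\<And>z. ?u (m z) z < 1"
    by metis
  define N where "N = Max (insert 0 (m ` F))"
  \<comment> \<open>A chance, uniform over \<open>F\<close>, of visiting \<open>x\<close> within
    \<open>N\<close> steps; the inserted 1 covers empty \<open>F\<close>.\<close>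
  define \<delta> where "\<delta> = Min (insert 1 ((\<lambda>z. 1 - ?u N z) ` F))"
  have u_N: "?u N z < 1" if "z \<in> F" for z
  proof -
    have "?u N z \<le> ?u (m z) z"
      using that fin by (intro decseqD[OF decseq_avoid_prob]) (auto simp: N_def)
    with m show ?thesis
      by (rule order.strict_trans1[rotated])
  qed
  have \<delta>: "\<delta> > 0" "\<And>z. z \<in> F \<Longrightarrow> \<delta> \<le> 1 - ?u N z"
    using fin u_N by (auto simp: \<delta>_def)

  \<comment> \<open>\<open>h z\<close> is the mean visiting time of \<open>x\<close> capped at
    \<open>N\<close>. By telescoping, a step of the killed chain never raises it and lowers it by at
    least \<open>\<delta>\<close> on \<open>F\<close>.\<close>
  define h where "h z = (\<Sum>k<N. ?u k z)" for z
  have h_nonneg: "0 \<le> h z" for z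
    by (simp add: h_def sum_nonneg)
  have Q_h: "Q h z = h z - 1 + ?u N z" for z
  proof -
    have "Q h z = (\<Sum>k<N. ?u (Suc k) z)"
      unfolding Q_def h_def avoid_prob_Suc sum_distrib_left
      by (rule Bochner_Integration.integral_sum) (rule int_u)
    also have "\<dots> = h z - 1 + ?u N z"
      unfolding h_def by (induction N) auto
    finally show ?thesis .
  qed
  have int_h: "integrable (measure_pmf (P z)) (\<lambda>v. of_bool (v \<noteq> x) * h v)" for z
    unfolding h_def sum_distrib_left by (intro Bochner_Integration.integrable_sum int_u)

  define b where "b = (\<Sum>z\<in>F. \<bar>measure_pmf.expectation (P z) f - f z\<bar>)"
  \<comment> \<open>On \<open>F\<close> the gain \<open>M * \<delta>\<close> from \<open>h\<close>
    pays for the worst increase \<open>b\<close> of \<open>f\<close> and leaves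
    \<open>\<epsilon>\<close>.\<close>
  define M where "M = (b + \<epsilon>) / \<delta>"
  have "0 \<le> b"
    by (simp add: b_def sum_nonneg)
  then have M: "0 \<le> M" "M * \<delta> = b + \<epsilon>"
    using \<delta>(1) \<open>\<epsilon> > 0\<close> by (auto simp: M_def)
  define g where "g z = f z + M * h z" for z
  have g_nonneg: "0 \<le> g z" for z
    using f_nonneg h_nonneg M by (simp add: g_def)
  have int_g: "integrable (measure_pmf (P z)) (\<lambda>v. of_bool (v \<noteq> x) * g v)" for z
    using int_f int_h by (simp add: g_def distrib_left mult.left_commute[of _ M])
  have Q_g: "Q g z \<le> g z - \<epsilon>" for z
  proof -
    have "Q g z = Q f z + M * Q h z"
      using int_f int_h by (simp add: Q_def g_def distrib_left mult.left_commute[of _ M])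
    moreover have "Q f z \<le> measure_pmf.expectation (P z) f"
      unfolding Q_def by (rule integral_mono) (use int_f f_int f_nonneg in \<open>auto split: split_of_bool\<close>)
    moreover have "measure_pmf.expectation (P z) f + M * (?u N z - 1) \<le> f z - \<epsilon>"
    proof (cases "z \<in> F")
      case True
      have "measure_pmf.expectation (P z) f - f z \<le> b"
        using member_le_sum[OF True, of "\<lambda>z. \<bar>measure_pmf.expectation (P z) f - f z\<bar>"] fin
        by (simp add: b_def)
      moreover have "M * \<delta> \<le> M * (1 - ?u N z)"
        using \<delta>(2)[OF True] M(1) by (rule mult_left_mono)
      ultimately show ?thesis
        using M(2) by (simp add: algebra_simps)
    next
      case False
      moreover have "M * (?u N z - 1) \<le> 0"
        using M(1) by (simp add: mult_nonneg_nonpos)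
      ultimately show ?thesis
        using drift[of z] by linarith
    qed
    ultimately show ?thesis
      unfolding Q_h g_def by (simp add: algebra_simps)
  qed

  \<comment> \<open>Each step survived by the killed chain consumes at least
    \<open>\<epsilon>\<close> of the nonnegative budget \<open>g\<close>.\<close>
  have "\<epsilon> * (\<Sum>n<k. ?u n z) \<le> g z" for k z
  proof (induction k arbitrary: z)
    case 0
    show ?case by (simp add: g_nonneg)
  next
    case (Suc k)
    have "\<epsilon> * (\<Sum>n<k. ?u (Suc n) z) = Q (\<lambda>v. \<epsilon> * (\<Sum>n<k. ?u n v)) z"
      unfolding Q_def avoid_prob_Suc using int_u
      by (simp add: sum_distrib_left mult.left_commute[of _ \<epsilon>])
    also have "\<dots> \<le> Q g z"
      unfolding Q_def
    proof (rule integral_mono)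
      show "integrable (measure_pmf (P z)) (\<lambda>v. of_bool (v \<noteq> x) * (\<epsilon> * (\<Sum>n<k. ?u n v)))"
        using int_u by (simp add: sum_distrib_left mult.left_commute[of _ \<epsilon>])
    qed (auto intro: int_g Suc.IH split: split_of_bool)
    also note Q_g
    finally show ?case
      unfolding sum.lessThan_Suc_shift by (simp add: distrib_left)
  qed
  then have "(\<Sum>n\<le>k. ?u n y) \<le> g y / \<epsilon>" for k
    using \<open>\<epsilon> > 0\<close> by (simp only: pos_le_divide_eq mult.commute[of _ \<epsilon>] flip: lessThan_Suc_atMost)
  then show ?thesis
    by (intro bounded_imp_summable) auto
qed

section \<open>Stationary distributions\<close>

lemma nn_integral_measure_pmf_split_state:
  fixes g :: "'s \<Rightarrow> ennreal"
  shows "(\<integral>\<^sup>+z. g z \<partial>measure_pmf p) =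
    (\<integral>\<^sup>+z. of_bool (z \<noteq> x) * g z \<partial>measure_pmf p) + ennreal (pmf p x) * g x"
proof -
  have "(\<integral>\<^sup>+z. g z \<partial>measure_pmf p) =
      (\<integral>\<^sup>+z. of_bool (z \<noteq> x) * g z + g x * indicator {x} z \<partial>measure_pmf p)"
    by (intro nn_integral_cong) (auto simp: indicator_def)
  also have "\<dots> = (\<integral>\<^sup>+z. of_bool (z \<noteq> x) * g z \<partial>measure_pmf p) + ennreal (pmf p x) * g x"
    by (simp add: nn_integral_add nn_integral_cmult emeasure_pmf_single mult.commute)
  finally show ?thesis .
qed

text \<open>
  The stationary distribution is the normalised occupation measure of an excursion from \<open>x\<close>.
  The functional \<open>\<Lambda>\<close> below integrates against this measure before normalisation.
\<close>

lemma ex_stationary: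
  fixes P :: "'s::countable \<Rightarrow> 's pmf"
  assumes sm: "summable (\<lambda>n. avoid_prob P x n x)"
  shows "\<exists>\<pi>. stationary P \<pi>"
proof -
  define Q where "Q g y = (\<integral>\<^sup>+z. of_bool (z \<noteq> x) * g z \<partial>measure_pmf (P y))"
    for g :: "'s \<Rightarrow> ennreal" and y
  define \<Lambda> where "\<Lambda> g = (\<Sum>n. (Q ^^ n) g x)" for g
  define c where "c y = ennreal (pmf (P y) x)" for y
  define m where "m = (\<Sum>n. avoid_prob P x n x)"

  have Q_add: "Q (\<lambda>z. g z + h z) y = Q g y + Q h y" for g h y
    unfolding Q_def by (simp add: distrib_left nn_integral_add)
  have Q_mult: "Q (\<lambda>z. a * g z) y = a * Q g y" for a g y
    unfolding Q_def by (simp add: nn_integral_cmult mult.left_commute[of _ a])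
  have Qn_add: "(Q ^^ n) (\<lambda>z. g z + h z) y = (Q ^^ n) g y + (Q ^^ n) h y" for n g h y
  proof (induction n arbitrary: y)
    case (Suc n)
    from Suc.IH have "(Q ^^ n) (\<lambda>z. g z + h z) = (\<lambda>y. (Q ^^ n) g y + (Q ^^ n) h y)" ..
    then show ?case by (simp only: funpow.simps o_apply Q_add)
  qed simp
  have Qn_mult: "(Q ^^ n) (\<lambda>z. a * g z) y = a * (Q ^^ n) g y" for n a g y
  proof (induction n arbitrary: y)
    case (Suc n)
    from Suc.IH have "(Q ^^ n) (\<lambda>z. a * g z) = (\<lambda>y. a * (Q ^^ n) g y)" ..
    then show ?case by (simp only: funpow.simps o_apply Q_mult)
  qed simp
  have Qn_1: "(Q ^^ n) (\<lambda>_. 1) y = ennreal (avoid_prob P x n y)" for n y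
  proof (induction n arbitrary: y)
    case (Suc n)
    from Suc.IH have "(Q ^^ n) (\<lambda>_. 1) = (\<lambda>y. ennreal (avoid_prob P x n y))" ..
    then have "(Q ^^ Suc n) (\<lambda>_. 1) y = Q (\<lambda>y. ennreal (avoid_prob P x n y)) y"
      by (simp only: funpow.simps o_apply)
    also have "\<dots> = (\<integral>\<^sup>+z. ennreal (of_bool (z \<noteq> x) * avoid_prob P x n z) \<partial>measure_pmf (P y))"
      unfolding Q_def by (intro nn_integral_cong) auto
    also have "\<dots> = ennreal (avoid_prob P x (Suc n) y)"
      unfolding avoid_prob_Suc
      by (intro nn_integral_eq_integral integrable_measure_pmf_bounded[where B = 1])
        (auto split: split_of_bool)
    finally show ?case .
  qed simp

  have \<Lambda>_1: "\<Lambda> (\<lambda>_. 1) = ennreal m"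
    unfolding \<Lambda>_def Qn_1 m_def by (intro suminf_ennreal2 sm) simp
  have \<Lambda>_add: "\<Lambda> (\<lambda>z. g z + h z) = \<Lambda> g + \<Lambda> h" for g h
    by (simp add: \<Lambda>_def Qn_add suminf_add)
  have \<Lambda>_mult: "\<Lambda> (\<lambda>z. a * g z) = a * \<Lambda> g" for a g
    by (simp add: \<Lambda>_def Qn_mult)
  have \<Lambda>_Q: "\<Lambda> g = g x + \<Lambda> (Q g)" for g
    unfolding \<Lambda>_def by (subst suminf_offset[of _ 1]) (simp_all add: funpow_swap1)
  have P_eq: "(\<integral>\<^sup>+z. g z \<partial>measure_pmf (P y)) = Q g y + g x * c y" for g y
    unfolding Q_def c_def nn_integral_measure_pmf_split_state[of "P y" g x]
    by (simp only: mult.commute)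
  \<comment> \<open>An excursion returns to \<open>x\<close> with total mass 1: mass balance gives
    this after cancelling \<open>\<Lambda> (Q (\<lambda>_. 1))\<close>, finite by
    summability.\<close>
  have "\<Lambda> c = 1"
  proof -
    have "1 = Q (\<lambda>_. 1) y + c y" for y
    proof -
      have "1 = (\<integral>\<^sup>+_. 1 \<partial>measure_pmf (P y))" by simp
      also have "\<dots> = Q (\<lambda>_. 1) y + 1 * c y" by (rule P_eq)
      finally show ?thesis by (simp only: mult_1_left)
    qed
    then have "(\<lambda>_. 1) = (\<lambda>y. Q (\<lambda>_. 1) y + c y)" ..
    then have "\<Lambda> (\<lambda>_. 1) = \<Lambda> (\<lambda>y. Q (\<lambda>_. 1) y + c y)"
      by (rule arg_cong)
    also have "\<dots> = \<Lambda> (Q (\<lambda>_. 1)) + \<Lambda> c"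
      by (rule \<Lambda>_add)
    finally have "\<Lambda> (Q (\<lambda>_. 1)) + 1 = \<Lambda> (Q (\<lambda>_. 1)) + \<Lambda> c"
      using \<Lambda>_Q[of "\<lambda>_. 1"] by (simp only: add.commute)
    moreover have "\<Lambda> (Q (\<lambda>_. 1)) \<noteq> \<top>"
      using \<Lambda>_Q[of "\<lambda>_. 1"] \<Lambda>_1 by (metis ennreal_add_eq_top ennreal_neq_top)
    ultimately show ?thesis
      by (simp add: ennreal_add_left_cancel)
  qed
  \<comment> \<open>The mass entering \<open>x\<close> restarts the excursion and replaces exactly
    the term of \<open>\<Lambda> g\<close> at time 0.\<close>
  then have \<Lambda>_P: "\<Lambda> (\<lambda>y. \<integral>\<^sup>+z. g z \<partial>measure_pmf (P y)) = \<Lambda> g" for g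
    by (simp only: P_eq \<Lambda>_add \<Lambda>_mult \<Lambda>_Q[of g]) (simp only: mult_1_right add.commute)

  \<comment> \<open>To turn the functional \<open>\<Lambda>\<close> into a measure, it is recovered
    from its values on singletons; the interchange of integrals rests on countability of the state
    space.\<close>
  have Qn_repr: "(Q ^^ n) g y = (\<integral>\<^sup>+v. g v * (Q ^^ n) (indicator {v}) y \<partial>count_space UNIV)"
    for n g y
  proof (induction n arbitrary: y)
    case 0
    have "(\<integral>\<^sup>+v. g v * indicator {v} y \<partial>count_space UNIV) =
        (\<integral>\<^sup>+v. g y * indicator {y} v \<partial>count_space UNIV)"
      by (intro nn_integral_cong) (auto simp: indicator_def)
    then show ?case by (simp add: nn_integral_cmult)
  next
    case (Suc n)
    have "(Q ^^ Suc n) g y = Q ((Q ^^ n) g) y"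
      by simp
    also have "(Q ^^ n) g = (\<lambda>z. \<integral>\<^sup>+v. g v * (Q ^^ n) (indicator {v}) z \<partial>count_space UNIV)"
      by (rule ext) (rule Suc.IH)
    also have "Q \<dots> y = (\<integral>\<^sup>+z. \<integral>\<^sup>+v. g v * (of_bool (z \<noteq> x) * (Q ^^ n) (indicator {v}) z)
        \<partial>count_space UNIV \<partial>measure_pmf (P y))"
      unfolding Q_def by (intro nn_integral_cong) (simp add: mult.left_commute flip: nn_integral_cmult)
    also have "\<dots> = (\<integral>\<^sup>+v. \<integral>\<^sup>+z. g v * (of_bool (z \<noteq> x) * (Q ^^ n) (indicator {v}) z)
        \<partial>measure_pmf (P y) \<partial>count_space UNIV)"
      by (rule nn_integral_count_space_nn_integral) auto
    also have "\<dots> = (\<integral>\<^sup>+v. g v * (Q ^^ Suc n) (indicator {v}) y \<partial>count_space UNIV)"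
      by (intro nn_integral_cong) (simp add: nn_integral_cmult Q_def)
    finally show ?case .
  qed
  have \<Lambda>_repr: "\<Lambda> g = (\<integral>\<^sup>+v. g v * \<Lambda> (indicator {v}) \<partial>count_space UNIV)" for g
    unfolding \<Lambda>_def by (subst Qn_repr) (simp add: nn_integral_suminf flip: ennreal_suminf_cmult)

  have "1 \<le> m"
    using sum_le_suminf[OF sm, of "{0}"] by (simp add: m_def)
  have \<Lambda>_ind: "\<Lambda> (indicator {v}) \<le> ennreal m" for v
  proof -
    have "\<Lambda> (indicator {v}) \<le> \<Lambda> (\<lambda>z. indicator {v} z + indicator (- {v}) z)"
      by (simp only: \<Lambda>_add) simp
    also have "(\<lambda>z. indicator {v} z + indicator (- {v}) z) = (\<lambda>_. 1 :: ennreal)"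
      by (auto simp: indicator_def fun_eq_iff)
    finally show ?thesis by (simp add: \<Lambda>_1)
  qed
  define p where "p v = enn2real (\<Lambda> (indicator {v})) / m" for v
  have p: "ennreal (p v) * ennreal m = \<Lambda> (indicator {v})" for v
  proof -
    have "ennreal (p v) * ennreal m = ennreal (p v * m)"
      using \<open>1 \<le> m\<close> by (intro ennreal_mult[symmetric]) (auto simp: p_def)
    also have "p v * m = enn2real (\<Lambda> (indicator {v}))"
      using \<open>1 \<le> m\<close> by (simp add: p_def)
    also have "\<dots> = \<Lambda> (indicator {v})"
      by (rule ennreal_enn2real) (rule order.strict_trans1[OF \<Lambda>_ind ennreal_less_top])
    finally show ?thesis .
  qed
  have p_int: "ennreal m * (\<integral>\<^sup>+v. ennreal (p v) * g v \<partial>count_space UNIV) = \<Lambda> g" for g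
  proof -
    have "\<Lambda> g = (\<integral>\<^sup>+v. ennreal m * (ennreal (p v) * g v) \<partial>count_space UNIV)"
      unfolding \<Lambda>_repr[of g] p[symmetric] by (simp only: ac_simps)
    also have "\<dots> = ennreal m * (\<integral>\<^sup>+v. ennreal (p v) * g v \<partial>count_space UNIV)"
      by (rule nn_integral_cmult) simp
    finally show ?thesis ..
  qed
  have m_cancel: "a = b" if "ennreal m * a = ennreal m * b" for a b
    using that \<open>1 \<le> m\<close> by (subst (asm) ennreal_mult_cancel_left) auto
  have p_nonneg: "0 \<le> p v" for v
    using \<open>1 \<le> m\<close> by (simp add: p_def)
  have p_sum: "(\<integral>\<^sup>+v. ennreal (p v) \<partial>count_space UNIV) = 1"
    by (rule m_cancel) (use p_int[of "\<lambda>_. 1"] \<Lambda>_1 in simp)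
  define \<pi> where "\<pi> = embed_pmf p"
  have \<pi>: "ennreal m * (\<integral>\<^sup>+v. g v \<partial>measure_pmf \<pi>) = \<Lambda> g" for g
    unfolding nn_integral_measure_pmf \<pi>_def pmf_embed_pmf[OF p_nonneg p_sum] by (rule p_int)
  have "stationary P \<pi>"
    unfolding stationary_def
  proof (rule pmf_eqI)
    fix v
    have "ennreal m * emeasure (bind_pmf \<pi> P) {v} = ennreal m * emeasure \<pi> {v}"
      using \<pi>[of "\<lambda>y. emeasure (P y) {v}"] \<pi>[of "indicator {v}"] \<Lambda>_P[of "indicator {v}"] by simp
    then have "emeasure (bind_pmf \<pi> P) {v} = emeasure \<pi> {v}"
      by (rule m_cancel)
    then show "pmf (bind_pmf \<pi> P) v = pmf \<pi> v"
      unfolding emeasure_pmf_single by simp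
  qed
  then show ?thesis ..
qed

lemma stationary_step_law:
  assumes "stationary P \<pi>"
  shows "bind_pmf \<pi> (\<lambda>x. step_law P x n) = \<pi>"
  using assms
  by (induction n) (simp_all add: bind_return_pmf' stationary_def flip: bind_assoc_pmf)

lemma stationary_pmf_pos:
  assumes irr: "irreducible_chain P" and st: "stationary P \<pi>"
  shows "0 < pmf \<pi> x"
proof -
  obtain y where y: "y \<in> set_pmf \<pi>"
    using set_pmf_not_empty by fast
  obtain n where "x \<in> set_pmf (step_law P y n)"
    using irr unfolding irreducible_chain_def by (metis pmf_positive_iff)
  with y have "x \<in> set_pmf (bind_pmf \<pi> (\<lambda>x. step_law P x n))"
    by auto
  then show ?thesis
    unfolding stationary_step_law[OF st] pmf_positive_iff .
qed

text \<open>
  The probability of avoiding \<open>x\<close> for \<open>n\<close> steps after a stationary start is nonincreasing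
  in \<open>n\<close>, with decrements \<open>pmf \<pi> x * avoid_prob P x n x\<close>.
\<close>

lemma stationary_avoid_prob_tendsto_0:
  assumes st: "stationary P \<pi>" and pos: "0 < pmf \<pi> x"
  shows "(\<lambda>n. avoid_prob P x n x) \<longlonglongrightarrow> 0"
proof -
  let ?u = "avoid_prob P x"
  define v where "v n = measure_pmf.expectation \<pi> (?u n)" for n
  have bnd: "integrable (measure_pmf p) (?u n)" for p n
    by (rule integrable_measure_pmf_bounded[where B = 1]) simp
  have v_Suc: "v (Suc n) = v n - ?u n x * pmf \<pi> x" for n
  proof -
    have "v (Suc n) = measure_pmf.expectation (bind_pmf \<pi> P) (\<lambda>z. of_bool (z \<noteq> x) * ?u n z)"
      unfolding v_def avoid_prob_Suc[abs_def]
      by (rule integral_bind_pmf_bounded[where B = 1, symmetric]) (auto split: split_of_bool)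
    also have "\<dots> = measure_pmf.expectation \<pi> (\<lambda>z. ?u n z - indicator {x} z * ?u n x)"
      using st unfolding stationary_def
      by (auto intro!: Bochner_Integration.integral_cong simp: indicator_def)
    also have "\<dots> = v n - ?u n x * pmf \<pi> x"
      unfolding v_def
      by (subst Bochner_Integration.integral_diff)
        (auto intro!: bnd integrable_measure_pmf_bounded[where B = 1]
          simp: measure_pmf_single mult.commute split: split_indicator)
    finally show ?thesis .
  qed
  have "decseq v"
    by (rule decseq_SucI) (simp add: v_Suc)
  moreover have "0 \<le> v n" for n
    by (simp add: v_def)
  ultimately obtain L where L: "v \<longlonglongrightarrow> L"
    using decseq_convergent by blast
  have "(\<lambda>n. (v n - v (Suc n)) / pmf \<pi> x) \<longlonglongrightarrow> (L - L) / pmf \<pi> x"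
    using pos by (intro tendsto_intros L LIMSEQ_Suc) auto
  then show ?thesis
    using pos by (simp add: v_Suc)
qed

text \<open>A lasting chance of avoiding \<open>x\<close> from \<open>y\<close>, weighted by the
  probability of the step from \<open>z\<close> to \<open>y\<close>, would also show up at
  \<open>z\<close>. The limit therefore propagates along a path out of \<open>x\<close>.\<close>

lemma avoid_prob_tendsto_0:
  assumes base: "(\<lambda>n. avoid_prob P x n x) \<longlonglongrightarrow> 0"
    and reach: "y \<in> set_pmf (step_law P x k)"
  shows "(\<lambda>n. avoid_prob P x n y) \<longlonglongrightarrow> 0"
  using reach
proof (induction k arbitrary: y)
  case 0
  with base show ?case by simp
next
  case (Suc k)
  then obtain z where z: "z \<in> set_pmf (step_law P x k)" "y \<in> set_pmf (P z)"
    by auto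
  show ?case
  proof (cases "y = x")
    case True
    with base show ?thesis by simp
  next
    case False
    have p: "0 < pmf (P z) y"
      using z(2) by (simp add: pmf_positive_iff)
    have "avoid_prob P x n y \<le> avoid_prob P x (Suc n) z / pmf (P z) y" for n
    proof -
      have "pmf (P z) y * (of_bool (y \<noteq> x) * avoid_prob P x n y) \<le> avoid_prob P x (Suc n) z"
        unfolding avoid_prob_Suc by (rule pmf_mult_le_expectation[where B = 1]) (auto split: split_of_bool)
      with False show ?thesis
        by (simp only: pos_le_divide_eq[OF p] mult.commute[of _ "pmf (P z) y"]) simp
    qed
    moreover have lim: "(\<lambda>n. avoid_prob P x (Suc n) z / pmf (P z) y) \<longlonglongrightarrow> 0"
      using LIMSEQ_Suc[OF Suc.IH[OF z(1)]] by (rule tendsto_divide_zero)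
    ultimately show ?thesis
      by (intro tendsto_sandwich[OF _ _ tendsto_const lim] always_eventually allI) auto
  qed
qed

section \<open>Convergence by coupling\<close>

definition product_chain :: "('s \<Rightarrow> 's pmf) \<Rightarrow> 's \<times> 's \<Rightarrow> ('s \<times> 's) pmf" where
  "product_chain P z = pair_pmf (P (fst z)) (P (snd z))"

lemma bind_pair_pmf_pair_pmf:
  "bind_pmf (pair_pmf A B) (\<lambda>z. pair_pmf (F (fst z)) (G (snd z))) =
     pair_pmf (bind_pmf A F) (bind_pmf B G)"
  unfolding pair_pmf_def bind_assoc_pmf bind_return_pmf fst_conv snd_conv
  by (rule bind_pmf_cong[OF refl]) (rule bind_commute_pmf)

lemma step_law_product_chain:
  "step_law (product_chain P) (x, y) n = pair_pmf (step_law P x n) (step_law P y n)"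
  by (induction n)
    (simp_all only: step_law.simps pair_return_pmf product_chain_def[abs_def]
      bind_pair_pmf_pair_pmf[where F = P and G = P])

lemma stationary_product_chain:
  assumes "stationary P \<pi>"
  shows "stationary (product_chain P) (pair_pmf \<pi> \<pi>)"
  using assms
  by (simp only: stationary_def product_chain_def[abs_def] bind_pair_pmf_pair_pmf[where F = P and G = P])

text \<open>
  The coupling inequality: once the independent chains meet at \<open>x\<close>, their laws agree. Hence only the
  avoidance of the single state \<open>(x, x)\<close> matters.
\<close>

lemma step_law_diff_le_avoid_prob:
  "\<bar>measure_pmf.prob (step_law P y n) B - measure_pmf.prob (step_law P z n) B\<bar>
     \<le> avoid_prob (product_chain P) (x, x) n (y, z)"
proof (induction n arbitrary: y z)
  case 0
  show ?case
    by (simp add: indicator_def)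
next
  case (Suc n)
  let ?T = "\<lambda>y. measure_pmf.prob (step_law P y n) B"
  let ?u = "avoid_prob (product_chain P) (x, x)"
  have T: "measure_pmf.prob (step_law P y (Suc n)) B = measure_pmf.expectation (P y) ?T" for y
    unfolding step_law_Suc_first by (rule measure_bind_pmf)
  have int: "integrable (measure_pmf p) (\<lambda>v. ?T (g v))" for p :: "('a \<times> 'a) pmf" and g
    by (rule integrable_measure_pmf_bounded[where B = 1]) simp
  have "measure_pmf.prob (step_law P y (Suc n)) B - measure_pmf.prob (step_law P z (Suc n)) B =
      measure_pmf.expectation (product_chain P (y, z)) (\<lambda>v. ?T (fst v) - ?T (snd v))"
    using expectation_pair_pmf_fst[of "P y" "P z" ?T] expectation_pair_pmf_snd[of "P y" "P z" ?T]
    unfolding T product_chain_def fst_conv snd_conv Bochner_Integration.integral_diff[OF int[of _ fst] int[of _ snd]]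
    by (simp only:)
  also have "\<bar>\<dots>\<bar> \<le> measure_pmf.expectation (product_chain P (y, z))
      (\<lambda>v. \<bar>?T (fst v) - ?T (snd v)\<bar>)"
    by (rule integral_abs_bound)
  also have "\<dots> \<le> measure_pmf.expectation (product_chain P (y, z))
      (\<lambda>v. of_bool (v \<noteq> (x, x)) * ?u n v)"
  proof (rule integral_mono)
    show "integrable (measure_pmf (product_chain P (y, z))) (\<lambda>v. \<bar>?T (fst v) - ?T (snd v)\<bar>)"
      by (rule integrable_abs[OF Bochner_Integration.integrable_diff[OF int[of _ fst] int[of _ snd]]])
    show "integrable (measure_pmf (product_chain P (y, z))) (\<lambda>v. of_bool (v \<noteq> (x, x)) * ?u n v)"
      by (rule integrable_measure_pmf_bounded[where B = 1]) (auto split: split_of_bool)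
    \<comment> \<open>At \<open>(x, x)\<close> both sides vanish; elsewhere this is the induction
      hypothesis.\<close>
    show "\<bar>?T (fst v) - ?T (snd v)\<bar> \<le> of_bool (v \<noteq> (x, x)) * ?u n v" for v
      using Suc.IH[of "fst v" "snd v"] by (cases "v = (x, x)") auto
  qed
  also have "\<dots> = ?u (Suc n) (y, z)"
    by (rule avoid_prob_Suc[symmetric])
  finally show ?case .
qed

text \<open>Waiting in the loop at \<open>x\<close> equalises the lengths of two paths out of
  \<open>x\<close>, so \<open>(x, x)\<close> leads to every pair.\<close>

theorem ergodic_chain_if_self_loop:
  fixes P :: "'s::countable \<Rightarrow> 's pmf"
  assumes irr: "irreducible_chain P" and sm: "summable (\<lambda>n. avoid_prob P x n x)"
    and loop: "0 < pmf (P x) x"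
  shows "ergodic_chain P"
proof -
  obtain \<pi> where st: "stationary P \<pi>"
    using ex_stationary[OF sm] by blast
  let ?u = "avoid_prob (product_chain P) (x, x)"
  have base: "(\<lambda>n. ?u n (x, x)) \<longlonglongrightarrow> 0"
    by (rule stationary_avoid_prob_tendsto_0[OF stationary_product_chain[OF st]])
      (simp add: pmf_pair stationary_pmf_pos[OF irr st])
  have stay: "x \<in> set_pmf (step_law P x k)" for k
    using loop by (induction k) (auto simp: pmf_positive_iff)
  have u_lim: "(\<lambda>n. ?u n (y, z)) \<longlonglongrightarrow> 0" for y z
  proof -
    obtain k l where "y \<in> set_pmf (step_law P x k)" "z \<in> set_pmf (step_law P x l)"
      using irr unfolding irreducible_chain_def by (metis pmf_positive_iff)
    then have "y \<in> set_pmf (step_law P x (l + k))" "z \<in> set_pmf (step_law P x (k + l))"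
      using stay set_step_law_add by metis+
    then have "(y, z) \<in> set_pmf (step_law (product_chain P) (x, x) (k + l))"
      by (simp add: step_law_product_chain add.commute)
    then show ?thesis
      by (rule avoid_prob_tendsto_0[OF base])
  qed
  \<comment> \<open>Averaging the coupling bound over a stationary second copy gives an error that
    is uniform in the event, hence a bound in total variation.\<close>
  define r where "r \<pi>' y n = measure_pmf.expectation \<pi>' (\<lambda>z. ?u n (y, z))" for \<pi>' y n
  have r_lim: "r \<pi>' y \<longlonglongrightarrow> 0" for \<pi>' y
    unfolding r_def
    using integral_dominated_convergence[of "\<lambda>_. 0" "measure_pmf \<pi>'" "\<lambda>n z. ?u n (y, z)" "\<lambda>_. 1"]
      u_lim by simp
  have r_bound: "\<bar>measure_pmf.prob (step_law P y n) B - measure_pmf.prob \<pi>' B\<bar> \<le> r \<pi>' y n"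
    if "stationary P \<pi>'" for \<pi>' y n B
  proof -
    let ?T = "\<lambda>y. measure_pmf.prob (step_law P y n) B"
    have int: "integrable (measure_pmf \<pi>') ?T"
      by (rule integrable_measure_pmf_bounded[where B = 1]) simp
    have "measure_pmf.prob \<pi>' B = measure_pmf.expectation \<pi>' ?T"
      using stationary_step_law[OF that, of n] measure_bind_pmf[of \<pi>' "\<lambda>y. step_law P y n" B] by simp
    then have "?T y - measure_pmf.prob \<pi>' B = measure_pmf.expectation \<pi>' (\<lambda>z. ?T y - ?T z)"
      using int by simp
    also have "\<bar>\<dots>\<bar> \<le> measure_pmf.expectation \<pi>' (\<lambda>z. \<bar>?T y - ?T z\<bar>)"
      by (rule integral_abs_bound)
    also have "\<dots> \<le> r \<pi>' y n"
      unfolding r_def using int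
      by (intro integral_mono step_law_diff_le_avoid_prob integrable_abs
          Bochner_Integration.integrable_diff integrable_const integrable_measure_pmf_bounded[where B = 1]) auto
    finally show ?thesis .
  qed
  have lim: "(\<lambda>n. measure_pmf.prob (step_law P y n) B) \<longlonglongrightarrow> measure_pmf.prob \<pi>' B"
    if "stationary P \<pi>'" for \<pi>' y B
    by (rule LIM_zero_cancel, rule Lim_null_comparison[OF _ r_lim[of \<pi>' y]])
      (simp add: r_bound[OF that])
  have uniq: "\<pi>' = \<pi>" if "stationary P \<pi>'" for \<pi>'
    using LIMSEQ_unique[OF lim[OF that, of x] lim[OF st, of x]]
    by (intro pmf_eqI) (simp flip: measure_pmf_single)
  have "(\<lambda>n. tv_dist (step_law P y n) \<pi>) \<longlonglongrightarrow> 0" for y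
  proof (rule tendsto_sandwich[OF _ _ tendsto_const r_lim[of \<pi> y]])
    let ?d = "\<lambda>n B. \<bar>measure_pmf.prob (step_law P y n) B - measure_pmf.prob \<pi> B\<bar>"
    have "tv_dist (step_law P y n) \<pi> \<le> r \<pi> y n" for n
      unfolding tv_dist_def by (rule cSUP_least) (auto intro: r_bound[OF st])
    then show "\<forall>\<^sub>F n in sequentially. tv_dist (step_law P y n) \<pi> \<le> r \<pi> y n"
      by simp
    have "0 \<le> tv_dist (step_law P y n) \<pi>" for n
      unfolding tv_dist_def
      by (rule cSUP_upper2[where x = "{}"]) (auto intro!: bdd_aboveI[of _ "r \<pi> y n"] r_bound[OF st])
    then show "\<forall>\<^sub>F n in sequentially. 0 \<le> tv_dist (step_law P y n) \<pi>"
      by simp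
  qed
  with st uniq show ?thesis
    unfolding ergodic_chain_def by blast
qed

section \<open>The service rates\<close>

definition pop :: "'v::finite rel \<Rightarrow> ('v \<Rightarrow> nat) \<Rightarrow> 'v \<Rightarrow> real" where
  "pop E w i = real (\<Sum>j\<in>nbhd E i. w j)"

text \<open>The probability that exactly one user at \<open>i\<close> attempts and the rest of the
  neighbourhood is silent. For \<open>w i = 0\<close> the first factor vanishes, whatever the
  truncated exponent.\<close>

definition service_rate :: "'v::finite rel \<Rightarrow> ('v \<Rightarrow> nat) \<Rightarrow> 'v \<Rightarrow> real" where
  "service_rate E w i = real (w i) * (1 / pop E w i) * (1 - 1 / pop E w i) ^ (w i - 1) *
     (\<Prod>j\<in>nbhd E i - {i}. (1 - 1 / pop E w j) ^ w j)"

lemma self_in_nbhd [simp]: "i \<in> nbhd E i"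
  by (simp add: nbhd_def)

lemma card_nbhd_pos: "0 < card (nbhd E i)" for E :: "'v::finite rel"
  by (auto simp: card_gt_0_iff nbhd_def)

lemma nbhd_commute: "sym E \<Longrightarrow> j \<in> nbhd E i \<longleftrightarrow> i \<in> nbhd E j"
  by (auto simp: nbhd_def dest: symD)

lemma pop_nonneg: "0 \<le> pop E w i"
  by (simp add: pop_def del: of_nat_sum)

lemma le_pop: "i \<in> nbhd E j \<Longrightarrow> real (w i) \<le> pop E w j"
  unfolding pop_def by (intro of_nat_mono member_le_sum) auto

lemma departures_le_1: "departures E m i \<le> 1"
proof -
  have "(\<Prod>j\<in>nbhd E i - {i}. of_bool (m j = 0)) \<le> (1 :: nat)"
    by (intro prod_le_1) auto
  then show ?thesis
    by (simp add: departures_def)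
qed

lemma sum_departures_le:
  fixes E :: "'v::finite rel"
  shows "(\<Sum>i\<in>UNIV. real (a i) + real (departures E m i)) \<le> (\<Sum>i\<in>UNIV. real (a i)) + real CARD('v)"
  using sum_mono[of UNIV "\<lambda>i. real (departures E m i)" "\<lambda>_. 1"]
  by (simp add: sum.distrib departures_le_1 del: One_nat_def)

text \<open>A departure indicator is a product of functions of single coordinates of
  \<open>m\<close>, so independence of the attempts factorises its mean.\<close>

lemma expectation_departures:
  "measure_pmf.expectation (attempts E w) (\<lambda>m. real (departures E m i)) = service_rate E w i"
proof -
  define g :: "'a \<Rightarrow> nat \<Rightarrow> real" where
    "g j k = (if j = i then of_bool (k = 1) else if j \<in> nbhd E i then of_bool (k = 0) else 1)" for j k
  let ?B = "\<lambda>j. binomial_pmf (w j) (1 / pop E w j)"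
  have split_prod: "(\<Prod>j\<in>UNIV. if j = i then c j else if j \<in> nbhd E i then b j else 1) =
      c i * (\<Prod>j\<in>nbhd E i - {i}. b j)" for b c :: "'a \<Rightarrow> real"
  proof -
    have "(\<Prod>j\<in>UNIV - {i}. if j = i then c j else if j \<in> nbhd E i then b j else 1) =
        (\<Prod>j\<in>nbhd E i - {i}. b j)"
      by (rule prod.mono_neutral_cong_right) auto
    then show ?thesis
      by (subst prod.remove[of UNIV i]) auto
  qed
  \<comment> \<open>Populations are integers and \<open>1 / 0 = 0\<close>, so every attempt
    probability is a valid binomial parameter.\<close>
  have p01: "0 \<le> 1 / pop E w j" "1 / pop E w j \<le> 1" for j
  proof -
    have "pop E w j = 0 \<or> 1 \<le> pop E w j"
      unfolding pop_def by (metis One_nat_def Suc_leI gr0I of_nat_0 of_nat_1 of_nat_le_iff)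
    then show "0 \<le> 1 / pop E w j" "1 / pop E w j \<le> 1"
      by auto
  qed
  have point: "measure_pmf.expectation p (\<lambda>k. of_bool (k = c)) = pmf p c" for p :: "nat pmf" and c
  proof -
    have "(\<lambda>k. of_bool (k = c) :: real) = indicator {c}"
      by (auto simp: indicator_def)
    then show ?thesis by (simp add: measure_pmf_single)
  qed
  have "real (departures E m i) = (\<Prod>j\<in>UNIV. g j (m j))" for m
    unfolding g_def split_prod departures_def by simp
  then have "measure_pmf.expectation (attempts E w) (\<lambda>m. real (departures E m i)) =
      measure_pmf.expectation (attempts E w) (\<lambda>m. \<Prod>j\<in>UNIV. g j (m j))"
    by simp
  also have "\<dots> = (\<Prod>j\<in>UNIV. measure_pmf.expectation (?B j) (g j))"
    unfolding attempts_def pop_def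
    by (rule expectation_prod_Pi_pmf)
      (auto simp: g_def intro!: integrable_measure_pmf_bounded[where B = 1] split: split_of_bool)
  also have "\<dots> = (\<Prod>j\<in>UNIV. if j = i then pmf (?B j) 1
      else if j \<in> nbhd E i then pmf (?B j) 0 else 1)"
    by (intro prod.cong refl) (auto simp: g_def[abs_def] point)
  also have "\<dots> = service_rate E w i"
    unfolding split_prod service_rate_def using p01 by (simp add: pmf_binomial)
  finally show ?thesis .
qed

text \<open>Since \<open>1 / (1 - 1 / s) = 1 + 1 / (s - 1) \<le> exp (1 / (s - 1))\<close>, the
  power is at least \<open>exp (- n / (s - 1))\<close>. Replacing \<open>s - 1\<close> by
  \<open>s\<close> costs \<open>(n / s) / (s - 1)\<close>, at most \<open>1 / (k - 1)\<close>. The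
  separate bound \<open>k\<close> will be \<open>w i\<close>, common to all neighbours of
  \<open>i\<close>.\<close>

lemma exp_le_one_minus_inverse_power:
  fixes s :: real
  assumes "2 \<le> k" "real k \<le> s" "real n \<le> s"
  shows "exp (- (real n / s) - 1 / (real k - 1)) \<le> (1 - 1 / s) ^ n"
proof -
  have s: "1 < s" and k: "1 < real k"
    using assms by linarith+
  have "exp (1 / (s - 1)) \<ge> 1 + 1 / (s - 1)"
    by (rule exp_ge_add_one_self)
  also have "1 + 1 / (s - 1) = inverse (1 - 1 / s)"
    using s by (simp add: field_simps)
  finally have "inverse (exp (1 / (s - 1))) \<le> inverse (inverse (1 - 1 / s))"
    using s by (intro le_imp_inverse_le) auto
  then have base: "exp (- 1 / (s - 1)) \<le> 1 - 1 / s"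
    by (simp add: exp_minus[symmetric])
  have "real n / (s - 1) = real n / s + (real n / s) * (1 / (s - 1))"
    using s by (simp add: field_simps)
  also have "(real n / s) * (1 / (s - 1)) \<le> 1 * (1 / (real k - 1))"
    using s k assms by (intro mult_mono divide_left_mono) auto
  finally have "- (real n / s) - 1 / (real k - 1) \<le> real n * (- 1 / (s - 1))"
    by simp
  then have "exp (- (real n / s) - 1 / (real k - 1)) \<le> exp (real n * (- 1 / (s - 1)))"
    by simp
  also have "\<dots> = exp (- 1 / (s - 1)) ^ n"
    by (rule exp_of_nat_mult)
  also have "\<dots> \<le> (1 - 1 / s) ^ n"
    using base by (rule power_mono) simp
  finally show ?thesis .
qed

text \<open>
  For large populations the service rate at \<open>i\<close> is close to \<open>x i * exp (- (\<Sum>j\<in>nbhd E i. x j))\<close> with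
  \<open>x j = w j / pop E w j\<close>. The error is of order \<open>1 / w i\<close>, so it stays bounded after multiplication
  by \<open>w i\<close>.
\<close>

lemma service_rate_ge:
  fixes E :: "'v::finite rel" and w :: "'v \<Rightarrow> nat"
  assumes "sym E"
  defines "x \<equiv> \<lambda>j. real (w j) / pop E w j"
  shows "real (w i) * (x i * exp (- (\<Sum>j\<in>nbhd E i. x j))) - 2 * real (card (nbhd E i))
    \<le> real (w i) * service_rate E w i"
proof -
  let ?N = "nbhd E i" and ?q = "\<lambda>j. 1 - 1 / pop E w j"
  define r where "r = x i * exp (- (\<Sum>j\<in>?N. x j))"
  have x01: "0 \<le> x j" "x j \<le> 1" for j
    using le_pop[of j E j w] by (auto simp: x_def divide_le_eq_1)
  have "r \<le> 1 * 1"
    unfolding r_def using x01 by (intro mult_mono) (auto intro: sum_nonneg)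
  moreover have "0 \<le> r"
    using x01 by (simp add: r_def)
  moreover have card: "1 \<le> card ?N"
    using card_nbhd_pos[of E i] by linarith
  moreover have q01: "0 \<le> ?q j" "?q j \<le> 1" for j
  proof -
    have "pop E w j = 0 \<or> 1 \<le> pop E w j"
      unfolding pop_def by (metis One_nat_def Suc_leI gr0I of_nat_0 of_nat_1 of_nat_le_iff)
    then show "0 \<le> ?q j" "?q j \<le> 1"
      by auto
  qed
  ultimately have rate_nonneg: "0 \<le> service_rate E w i"
    unfolding service_rate_def
    by (intro mult_nonneg_nonneg prod_nonneg zero_le_power divide_nonneg_nonneg pop_nonneg) auto
  show ?thesis
  proof (cases "2 \<le> w i")
    case False
    then have "real (w i) * r \<le> 1 * 1"
      using \<open>r \<le> 1 * 1\<close> \<open>0 \<le> r\<close> by (intro mult_mono) auto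
    moreover have "0 \<le> real (w i) * service_rate E w i"
      using rate_nonneg by simp
    ultimately show ?thesis
      using card unfolding r_def by linarith
  next
    case True
    \<comment> \<open>One error \<open>\<eta>\<close> per vertex of the neighbourhood;
      \<open>w i \<ge> 2\<close> yields \<open>w i * \<eta> \<le> 2\<close>, the source of the
      constant 2.\<close>
    define \<eta> where "\<eta> = 1 / (real (w i) - 1)"
    have \<eta>: "0 \<le> \<eta>" "real (w i) * \<eta> \<le> 2"
      using True by (auto simp: \<eta>_def field_simps)
    have "r * exp (- (real (card ?N) * \<eta>)) = x i * (\<Prod>j\<in>?N. exp (- x j - \<eta>))"
      by (simp add: r_def sum_subtractf sum_negf flip: exp_sum exp_add)
    also have "\<dots> \<le> x i * (\<Prod>j\<in>?N. ?q j ^ w j)"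
    proof (intro mult_left_mono prod_mono conjI)
      fix j assume "j \<in> ?N"
      \<comment> \<open>By symmetry \<open>i\<close> lies in the neighbourhood of \<open>j\<close>,
        so a large queue at \<open>i\<close> alone makes every relevant population large.\<close>
      then have "real (w i) \<le> pop E w j"
        using nbhd_commute[OF assms(1)] by (intro le_pop) auto
      then show "exp (- x j - \<eta>) \<le> ?q j ^ w j"
        unfolding x_def \<eta>_def
        by (rule exp_le_one_minus_inverse_power[OF True _ le_pop[OF self_in_nbhd]])
    qed (use x01 in auto)
    also have "(\<Prod>j\<in>?N. ?q j ^ w j) = ?q i ^ w i * (\<Prod>j\<in>?N - {i}. ?q j ^ w j)"
      by (rule prod.remove) auto
    also have "x i * \<dots> \<le> x i * (?q i ^ (w i - 1) * (\<Prod>j\<in>?N - {i}. ?q j ^ w j))"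
      using x01 q01 by (intro mult_left_mono mult_right_mono power_decreasing prod_nonneg) auto
    also have "\<dots> = service_rate E w i"
      by (simp add: service_rate_def x_def mult.assoc)
    finally have rate: "r * exp (- (real (card ?N) * \<eta>)) \<le> service_rate E w i" .
    have "r - real (card ?N) * \<eta> \<le> r * (1 - real (card ?N) * \<eta>)"
      using mult_right_mono[OF \<open>r \<le> 1 * 1\<close>, of "real (card ?N) * \<eta>"] \<eta>
      by (simp add: algebra_simps)
    also have "\<dots> \<le> r * exp (- (real (card ?N) * \<eta>))"
      using exp_ge_add_one_self[of "- (real (card ?N) * \<eta>)"] \<open>0 \<le> r\<close>
      by (intro mult_left_mono) auto
    also note rate
    finally have "real (w i) * (r - real (card ?N) * \<eta>) \<le> real (w i) * service_rate E w i"
      by (rule mult_left_mono) simp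
    moreover have "real (card ?N) * (real (w i) * \<eta>) \<le> real (card ?N) * 2"
      using \<eta>(2) by (rule mult_left_mono) simp
    ultimately show ?thesis
      unfolding r_def by (simp add: algebra_simps)
  qed
qed

text \<open>
  The weights \<open>x j = w j / pop E w j\<close> are the proportionally fair attempt probabilities: they maximise
  \<open>\<Sum>i. w i * ln (p i * exp (- (\<Sum>j\<in>nbhd E i. p j)))\<close> over \<open>p\<close>. The claim compares them
  with the constant choice \<open>p = 1 / V\<close>, which yields the rate \<open>exp (-1) / V\<close>.
\<close>

lemma proportional_fairness:
  fixes E :: "'v::finite rel" and w :: "'v \<Rightarrow> nat"
  assumes "sym E" and V: "\<And>i. card (nbhd E i) = V"
  defines "x \<equiv> \<lambda>j. real (w j) / pop E w j"
  shows "exp (- 1) / real V * (\<Sum>i\<in>UNIV. real (w i)) \<le>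
    (\<Sum>i\<in>UNIV. real (w i) * (x i * exp (- (\<Sum>j\<in>nbhd E i. x j))))"
proof -
  have "V > 0"
    using V[of undefined] card_nbhd_pos[of E undefined] by simp
  define \<nu> where "\<nu> = exp (- 1) / real V"
  define r where "r i = x i * exp (- (\<Sum>j\<in>nbhd E i. x j))" for i
  have "\<nu> > 0"
    using \<open>V > 0\<close> by (simp add: \<nu>_def)
  have swap: "(\<Sum>i\<in>UNIV. \<Sum>j\<in>nbhd E i. f i j) = (\<Sum>j\<in>UNIV. \<Sum>i\<in>nbhd E j. f i j)"
    for f :: "'v \<Rightarrow> 'v \<Rightarrow> real"
  proof -
    have "(\<Sum>i\<in>UNIV. \<Sum>j\<in>nbhd E i. f i j) = (\<Sum>i\<in>UNIV. \<Sum>j\<in>{j \<in> UNIV. j \<in> nbhd E i}. f i j)"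
      by simp
    also have "\<dots> = (\<Sum>j\<in>UNIV. \<Sum>i\<in>{i \<in> UNIV. j \<in> nbhd E i}. f i j)"
      by (rule sum.swap_restrict) auto
    also have "\<dots> = (\<Sum>j\<in>UNIV. \<Sum>i\<in>nbhd E j. f i j)"
      using nbhd_commute[OF assms(1)] by (intro sum.cong) auto
    finally show ?thesis .
  qed
  have x_pop: "x j * pop E w j = real (w j)" for j
    using le_pop[of j E j w] by (auto simp: x_def)
  have sum_x: "(\<Sum>i\<in>UNIV. real (w i) * (\<Sum>j\<in>nbhd E i. x j)) = (\<Sum>i\<in>UNIV. real (w i))"
  proof -
    have "(\<Sum>i\<in>UNIV. real (w i) * (\<Sum>j\<in>nbhd E i. x j)) =
        (\<Sum>j\<in>UNIV. \<Sum>i\<in>nbhd E j. real (w i) * x j)"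
      unfolding sum_distrib_left by (rule swap)
    also have "\<dots> = (\<Sum>j\<in>UNIV. x j * pop E w j)"
      by (simp add: pop_def sum_distrib_left mult.commute)
    finally show ?thesis by (simp add: x_pop)
  qed
  have sum_pop: "(\<Sum>i\<in>UNIV. pop E w i) = real V * (\<Sum>i\<in>UNIV. real (w i))"
  proof -
    have "(\<Sum>i\<in>UNIV. pop E w i) = (\<Sum>j\<in>UNIV. \<Sum>i\<in>nbhd E j. real (w j))"
      unfolding pop_def of_nat_sum by (rule swap)
    then show ?thesis
      by (simp add: V sum_distrib_left)
  qed
  \<comment> \<open>The bound \<open>ln t \<le> t - 1\<close> is used at \<open>r i / \<nu>\<close>,
    and at \<open>1 / (real V * x i)\<close> to bound \<open>ln (real V * x i)\<close> from below.
    By \<open>sum_x\<close> and \<open>sum_pop\<close> the left sides sum to zero.\<close>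
  have "real (w i) * (2 - (\<Sum>j\<in>nbhd E i. x j)) - pop E w i / real V \<le>
      real (w i) * (r i / \<nu> - 1)" for i
  proof (cases "w i = 0")
    case True
    then show ?thesis
      using pop_nonneg[of E w i] by simp
  next
    case False
    then have "0 < pop E w i"
      using le_pop[of i E i w] by simp
    then have "0 < x i"
      using False by (simp add: x_def)
    have "ln (1 / (real V * x i)) \<le> 1 / (real V * x i) - 1"
      using \<open>0 < x i\<close> \<open>V > 0\<close> by (intro ln_le_minus_one) simp
    then have "1 - 1 / (real V * x i) \<le> ln (real V * x i)"
      using \<open>0 < x i\<close> \<open>V > 0\<close> by (simp add: ln_div)
    also have "ln (real V * x i) = ln (r i / \<nu>) + (\<Sum>j\<in>nbhd E i. x j) - 1"
      using \<open>0 < x i\<close> \<open>V > 0\<close> by (simp add: r_def \<nu>_def ln_div ln_mult)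
    also have "ln (r i / \<nu>) \<le> r i / \<nu> - 1"
      using \<open>0 < x i\<close> \<open>\<nu> > 0\<close> by (intro ln_le_minus_one) (simp add: r_def)
    finally have "2 - (\<Sum>j\<in>nbhd E i. x j) - 1 / (real V * x i) \<le> r i / \<nu> - 1"
      by simp
    then have "real (w i) * (2 - (\<Sum>j\<in>nbhd E i. x j) - 1 / (real V * x i)) \<le>
        real (w i) * (r i / \<nu> - 1)"
      by (rule mult_left_mono) simp
    moreover have "real (w i) * (1 / (real V * x i)) = pop E w i / real V"
      using False \<open>0 < pop E w i\<close> \<open>V > 0\<close> by (simp add: x_def)
    ultimately show ?thesis
      by (simp add: algebra_simps)
  qed
  then have "(\<Sum>i\<in>UNIV. real (w i) * (2 - (\<Sum>j\<in>nbhd E i. x j)) - pop E w i / real V) \<le>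
      (\<Sum>i\<in>UNIV. real (w i) * (r i / \<nu> - 1))"
    by (intro sum_mono)
  moreover have "(\<Sum>i\<in>UNIV. real (w i) * (2 - (\<Sum>j\<in>nbhd E i. x j)) - pop E w i / real V) = 0"
    using sum_x sum_pop \<open>V > 0\<close>
    by (simp add: right_diff_distrib sum_subtractf mult.commute[of _ 2]
        flip: sum_distrib_left sum_divide_distrib)
  moreover have "(\<Sum>i\<in>UNIV. real (w i) * (r i / \<nu> - 1)) =
      (\<Sum>i\<in>UNIV. real (w i) * r i) / \<nu> - (\<Sum>i\<in>UNIV. real (w i))"
    by (simp add: right_diff_distrib sum_subtractf sum_divide_distrib)
  ultimately have "(\<Sum>i\<in>UNIV. real (w i)) \<le> (\<Sum>i\<in>UNIV. real (w i) * r i) / \<nu>"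
    by linarith
  then have "\<nu> * (\<Sum>i\<in>UNIV. real (w i)) \<le> (\<Sum>i\<in>UNIV. real (w i) * r i)"
    using \<open>\<nu> > 0\<close> by (simp add: pos_le_divide_eq mult.commute)
  then show ?thesis
    unfolding r_def \<nu>_def .
qed

section \<open>Drift of the Euclidean norm\<close>

definition enorm :: "('v::finite \<Rightarrow> nat) \<Rightarrow> real" where
  "enorm w = sqrt (\<Sum>i\<in>UNIV. (real (w i))\<^sup>2)"

lemma enorm_nonneg [simp]: "0 \<le> enorm w"
  by (simp add: enorm_def sum_nonneg)

lemma enorm_power2: "(enorm w)\<^sup>2 = (\<Sum>i\<in>UNIV. (real (w i))\<^sup>2)"
  by (simp add: enorm_def sum_nonneg)

lemma le_enorm: "real (w i) \<le> enorm w"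
  unfolding enorm_def by (intro real_le_rsqrt member_le_sum) auto

lemma enorm_le_sum: "enorm w \<le> (\<Sum>i\<in>UNIV. real (w i))"
  using L2_set_le_sum[of UNIV "\<lambda>i. real (w i)"] by (simp add: enorm_def L2_set_def)

lemma finite_enorm_le: "finite {w :: 'v::finite \<Rightarrow> nat. enorm w < R}"
proof (rule finite_subset)
  show "{w :: 'v \<Rightarrow> nat. enorm w < R} \<subseteq> {w. range w \<subseteq> {..nat \<lfloor>R\<rfloor>}}"
  proof safe
    fix w :: "'v \<Rightarrow> nat" and i assume "enorm w < R"
    then have "real (w i) \<le> R"
      using le_enorm[of w i] by linarith
    then show "w i \<le> nat \<lfloor>R\<rfloor>"
      by (rule le_nat_floor)
  qed
  show "finite {w :: 'v \<Rightarrow> nat. range w \<subseteq> {..nat \<lfloor>R\<rfloor>}}"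
    using finite_set_of_finite_funs[of "UNIV :: 'v set" "{..nat \<lfloor>R\<rfloor>}" 0]
    by (simp add: image_subset_iff)
qed

lemma enorm_step_power2:
  fixes w a d :: "'v::finite \<Rightarrow> nat" and b :: real
  assumes "(\<Sum>i\<in>UNIV. real (a i) + real (d i)) \<le> b"
  shows "(enorm (\<lambda>i. w i + a i - d i))\<^sup>2 \<le>
    (enorm w)\<^sup>2 + 2 * (\<Sum>i\<in>UNIV. real (w i) * (real (a i) - real (d i))) + b\<^sup>2"
proof -
  have "(enorm (\<lambda>i. w i + a i - d i))\<^sup>2 \<le> (\<Sum>i\<in>UNIV. (real (w i) + (real (a i) - real (d i)))\<^sup>2)"
    unfolding enorm_power2
  proof (rule sum_mono)
    fix i
    \<comment> \<open>If the natural subtraction truncates, the left side is zero.\<close>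
    show "(real (w i + a i - d i))\<^sup>2 \<le> (real (w i) + (real (a i) - real (d i)))\<^sup>2"
      by (cases "d i \<le> w i + a i") (simp_all add: of_nat_diff add_diff_eq)
  qed
  also have "\<dots> = (enorm w)\<^sup>2 + 2 * (\<Sum>i\<in>UNIV. real (w i) * (real (a i) - real (d i))) +
      (\<Sum>i\<in>UNIV. (real (a i) - real (d i))\<^sup>2)"
    by (simp add: enorm_power2 power2_sum sum.distrib sum_distrib_left mult.assoc)
  also have "(\<Sum>i\<in>UNIV. (real (a i) - real (d i))\<^sup>2) \<le> (\<Sum>i\<in>UNIV. (real (a i) + real (d i))\<^sup>2)"
    by (intro sum_mono) (simp add: power2_sum power2_diff)
  also have "\<dots> \<le> (\<Sum>i\<in>UNIV. real (a i) + real (d i))\<^sup>2"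
    using power_mono[OF L2_set_le_sum[of UNIV "\<lambda>i. real (a i) + real (d i)"], of 2]
    by (simp add: L2_set_def sum_nonneg)
  also have "\<dots> \<le> b\<^sup>2"
    using assms by (intro power_mono) (auto intro: sum_nonneg)
  finally show ?thesis by simp
qed

lemma weighted_sum_le_enorm:
  assumes "\<And>i. 0 \<le> c i"
  shows "(\<Sum>i\<in>UNIV. real (w i) * c i) \<le> enorm w * (\<Sum>i\<in>UNIV. c i)"
  unfolding sum_distrib_left using assms by (intro sum_mono mult_right_mono le_enorm) auto

text \<open>
  Only first moments of the increments are available, so the second order term is truncated. The
  linear bound \<open>2 * b\<close> makes it integrable, the quadratic one makes it small for large \<open>R\<close>.
\<close>

lemma enorm_step:
  fixes w a d :: "'v::finite \<Rightarrow> nat" and b R :: real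
  assumes b: "(\<Sum>i\<in>UNIV. real (a i) + real (d i)) \<le> b"
  shows enorm_step_lipschitz: "enorm (\<lambda>i. w i + a i - d i) \<le> enorm w + b"
    and enorm_step_drift: "0 < R \<Longrightarrow> R \<le> enorm w \<Longrightarrow> enorm (\<lambda>i. w i + a i - d i) \<le>
      enorm w + (\<Sum>i\<in>UNIV. real (w i) * (real (a i) - real (d i))) / enorm w + min (2 * b) (b\<^sup>2 / (2 * R))"
proof -
  let ?f = "enorm w" and ?f' = "enorm (\<lambda>i. w i + a i - d i)"
  let ?s = "\<Sum>i\<in>UNIV. real (w i) * (real (a i) - real (d i))"
  have sq: "?f'\<^sup>2 \<le> ?f\<^sup>2 + 2 * ?s + b\<^sup>2"
    by (rule enorm_step_power2[OF b])
  have ad: "(\<Sum>i\<in>UNIV. real (a i)) \<le> b" "(\<Sum>i\<in>UNIV. real (d i)) \<le> b"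
    by (rule order_trans[OF sum_mono b], simp)+
  have "0 \<le> b"
    by (rule order_trans[OF sum_nonneg ad(1)]) simp
  have s_upper: "?s \<le> ?f * b"
  proof -
    have "?s \<le> (\<Sum>i\<in>UNIV. real (w i) * real (a i))"
      by (intro sum_mono mult_left_mono) auto
    also have "\<dots> \<le> ?f * (\<Sum>i\<in>UNIV. real (a i))"
      by (rule weighted_sum_le_enorm) simp
    also have "\<dots> \<le> ?f * b"
      using ad by (intro mult_left_mono) auto
    finally show ?thesis .
  qed
  have s_lower: "- (?f * b) \<le> ?s"
  proof -
    have "(\<Sum>i\<in>UNIV. real (w i) * real (d i)) \<le> ?f * (\<Sum>i\<in>UNIV. real (d i))"
      by (rule weighted_sum_le_enorm) simp
    also have "\<dots> \<le> ?f * b"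
      using ad by (intro mult_left_mono) auto
    finally have "- (?f * b) \<le> (\<Sum>i\<in>UNIV. - (real (w i) * real (d i)))"
      by (simp add: sum_negf)
    also have "\<dots> \<le> ?s"
      by (intro sum_mono) (simp add: right_diff_distrib)
    finally show ?thesis .
  qed
  have "?f'\<^sup>2 \<le> (?f + b)\<^sup>2"
    using sq s_upper by (simp add: power2_sum mult.assoc)
  then show lip: "?f' \<le> ?f + b"
    by (rule power2_le_imp_le) (simp add: \<open>0 \<le> b\<close>)
  assume R: "0 < R" "R \<le> ?f"
  then have "0 < ?f" by linarith
  \<comment> \<open>The first order term is at least \<open>- b\<close>, so inserting it into the
    Lipschitz bound costs a second \<open>b\<close>.\<close>
  have "- b \<le> ?s / ?f"
    using s_lower \<open>0 < ?f\<close> by (simp add: pos_le_divide_eq mult.commute)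
  with lip have 1: "?f' \<le> ?f + ?s / ?f + 2 * b"
    by linarith
  \<comment> \<open>This is the tangent line of the square root at the square of the old
    norm.\<close>
  have "2 * ?f * ?f' \<le> ?f\<^sup>2 + ?f'\<^sup>2"
    using sum_squares_bound[of ?f ?f'] by simp
  also have "\<dots> \<le> 2 * ?f\<^sup>2 + 2 * ?s + b\<^sup>2"
    using sq by simp
  also have "\<dots> = 2 * ?f * (?f + ?s / ?f + b\<^sup>2 / (2 * ?f))"
    using \<open>0 < ?f\<close> by (simp add: field_simps power2_eq_square)
  finally have "?f' \<le> ?f + ?s / ?f + b\<^sup>2 / (2 * ?f)"
    using \<open>0 < ?f\<close> by simp
  also have "b\<^sup>2 / (2 * ?f) \<le> b\<^sup>2 / (2 * R)"
    using R by (intro divide_left_mono) auto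
  finally show "?f' \<le> ?f + ?s / ?f + min (2 * b) (b\<^sup>2 / (2 * R))"
    using 1 by simp
qed


section \<open>Drift of the queue chain\<close>

lemma queue_kernel_eq_map_pmf:
  "queue_kernel E \<alpha> w =
     map_pmf (\<lambda>z i. w i + snd z i - departures E (fst z) i) (pair_pmf (attempts E w) \<alpha>)"
  unfolding queue_kernel_def pair_pmf_def map_bind_pmf
  by (simp add: map_pmf_def bind_return_pmf)

lemma integrable_pair_pmf_snd:
  fixes g :: "'b \<Rightarrow> real"
  assumes "integrable (measure_pmf q) g"
  shows "integrable (measure_pmf (pair_pmf p q)) (\<lambda>z. g (snd z))"
  using assms integrable_map_pmf_eq[of snd "pair_pmf p q" g] by (simp add: map_snd_pair_pmf)

lemma integrable_enorm_queue_kernel: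
  fixes E :: "'v::finite rel"
  assumes int: "\<And>i. integrable (measure_pmf \<alpha>) (\<lambda>a. real (a i))"
  shows "integrable (measure_pmf (queue_kernel E \<alpha> w)) enorm"
proof -
  let ?b = "\<lambda>a :: 'v \<Rightarrow> nat. (\<Sum>i\<in>UNIV. real (a i)) + real CARD('v)"
  have "integrable (measure_pmf (pair_pmf (attempts E w) \<alpha>))
      (\<lambda>z. enorm (\<lambda>i. w i + snd z i - departures E (fst z) i))"
  proof (rule Bochner_Integration.integrable_bound)
    show "integrable (measure_pmf (pair_pmf (attempts E w) \<alpha>)) (\<lambda>z. enorm w + ?b (snd z))"
      by (rule integrable_pair_pmf_snd) (intro Bochner_Integration.integrable_add
        Bochner_Integration.integrable_sum int measure_pmf.integrable_const)
    have "enorm (\<lambda>i. w i + a i - departures E m i) \<le> enorm w + ?b a" for a m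
      by (rule enorm_step_lipschitz[OF sum_departures_le])
    then show "AE z in pair_pmf (attempts E w) \<alpha>.
        norm (enorm (\<lambda>i. w i + snd z i - departures E (fst z) i)) \<le> norm (enorm w + ?b (snd z))"
      by (intro AE_pmfI) (simp add: add_nonneg_nonneg sum_nonneg)
  qed simp
  then show ?thesis
    by (simp add: queue_kernel_eq_map_pmf)
qed

text \<open>Dominated convergence: the quadratic branch gives the pointwise limit, the linear branch
  the integrable majorant.\<close>

lemma truncated_square_expectation_tendsto_0:
  fixes b :: "'a \<Rightarrow> real"
  assumes int: "integrable (measure_pmf p) b" and nonneg: "\<And>a. 0 \<le> b a"
  shows "((\<lambda>n. measure_pmf.expectation p (\<lambda>a. min (2 * b a) ((b a)\<^sup>2 / (2 * real (Suc n))))) \<longlonglongrightarrow> 0)"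
proof -
  have "(\<lambda>n. measure_pmf.expectation p (\<lambda>a. min (2 * b a) ((b a)\<^sup>2 / (2 * real (Suc n)))))
      \<longlonglongrightarrow> measure_pmf.expectation p (\<lambda>_. 0)"
  proof (rule integral_dominated_convergence[where w = "\<lambda>a. 2 * b a"])
    have "(\<lambda>n. min (2 * b a) ((b a)\<^sup>2 / (2 * real (Suc n)))) \<longlonglongrightarrow> 0" for a
    proof (rule tendsto_sandwich[OF _ _ tendsto_const])
      show "(\<lambda>n. (b a)\<^sup>2 / 2 * inverse (real (Suc n))) \<longlonglongrightarrow> 0"
        by (intro tendsto_mult_right_zero LIMSEQ_inverse_real_of_nat)
    qed (auto simp: nonneg field_simps)
    then show "AE a in p. (\<lambda>n. min (2 * b a) ((b a)\<^sup>2 / (2 * real (Suc n)))) \<longlonglongrightarrow> 0"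
      by simp
    show "AE a in p. norm (min (2 * b a) ((b a)\<^sup>2 / (2 * real (Suc n)))) \<le> 2 * b a" for n
      using nonneg by (intro AE_pmfI) (auto simp: abs_of_nonneg)
  qed (use int in auto)
  then show ?thesis by simp
qed

text \<open>The two error terms depend on the state only through the lower bound \<open>R\<close> on
  its norm, so one large \<open>R\<close> serves all states outside a ball.\<close>

lemma enorm_drift:
  fixes E :: "'v::finite rel" and \<alpha> :: "('v \<Rightarrow> nat) pmf" and lam :: real
  assumes sym: "sym E" and int: "\<And>i. integrable (measure_pmf \<alpha>) (\<lambda>a. real (a i))"
    and mean: "\<And>i. measure_pmf.expectation \<alpha> (\<lambda>a. real (a i)) = lam"
    and V: "\<And>i. card (nbhd E i) = V"
    and R: "0 < R" "R \<le> enorm w" and lam: "lam \<le> exp (- 1) / real V"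
  defines "b \<equiv> \<lambda>a :: 'v \<Rightarrow> nat. (\<Sum>i\<in>UNIV. real (a i)) + real CARD('v)"
  shows "measure_pmf.expectation (queue_kernel E \<alpha> w) enorm \<le>
    enorm w - (exp (- 1) / real V - lam) + 2 * real V * real CARD('v) / R +
    measure_pmf.expectation \<alpha> (\<lambda>a. min (2 * b a) ((b a)\<^sup>2 / (2 * R)))"
proof -
  let ?p = "pair_pmf (attempts E w) \<alpha>"
  let ?e = "\<lambda>a. min (2 * b a) ((b a)\<^sup>2 / (2 * R))"
  let ?s = "\<lambda>z. \<Sum>i\<in>UNIV. real (w i) * (real (snd z i) - real (departures E (fst z) i))"
  have pos: "0 < enorm w"
    using R by linarith
  have b_nonneg: "0 \<le> b a" for a
    by (simp add: b_def sum_nonneg add_nonneg_nonneg)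
  have int_b: "integrable (measure_pmf \<alpha>) b"
    unfolding b_def by (intro Bochner_Integration.integrable_add
        Bochner_Integration.integrable_sum int measure_pmf.integrable_const)
  have int_e: "integrable (measure_pmf ?p) (\<lambda>z. ?e (snd z))"
  proof (rule integrable_pair_pmf_snd, rule Bochner_Integration.integrable_bound)
    show "integrable (measure_pmf \<alpha>) (\<lambda>a. 2 * b a)"
      using int_b by simp
    show "AE a in \<alpha>. norm (?e a) \<le> norm (2 * b a)"
      using b_nonneg R by (intro AE_pmfI) (simp add: abs_of_nonneg)
  qed simp
  have int_a: "integrable (measure_pmf ?p) (\<lambda>z. real (snd z i))" for i
    by (rule integrable_pair_pmf_snd[OF int])
  have int_d: "integrable (measure_pmf ?p) (\<lambda>z. real (departures E (fst z) i))" for i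
    by (rule integrable_measure_pmf_bounded[where B = 1]) (simp add: departures_le_1 del: One_nat_def)
  have int_s: "integrable (measure_pmf ?p) ?s"
    by (intro Bochner_Integration.integrable_sum integrable_mult_right
        Bochner_Integration.integrable_diff int_a int_d)
  have exp_a: "measure_pmf.expectation ?p (\<lambda>z. real (snd z i)) = lam" for i
    using expectation_pair_pmf_snd[of "attempts E w" \<alpha> "\<lambda>a. real (a i)"] mean by simp
  have exp_d: "measure_pmf.expectation ?p (\<lambda>z. real (departures E (fst z) i)) = service_rate E w i" for i
    using expectation_pair_pmf_fst[of "attempts E w" \<alpha> "\<lambda>m. real (departures E m i)"]
    by (simp add: expectation_departures)
  have "measure_pmf.expectation ?p ?s = (\<Sum>i\<in>UNIV. real (w i) * (lam - service_rate E w i))"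
    by (subst Bochner_Integration.integral_sum)
      (simp_all add: int_a int_d exp_a exp_d)
  also have "\<dots> = lam * (\<Sum>i\<in>UNIV. real (w i)) - (\<Sum>i\<in>UNIV. real (w i) * service_rate E w i)"
    by (simp add: right_diff_distrib sum_subtractf sum_distrib_left mult.commute)
  also have "\<dots> \<le> (lam - exp (- 1) / real V) * (\<Sum>i\<in>UNIV. real (w i)) + 2 * real V * real CARD('v)"
  proof -
    let ?x = "\<lambda>j. real (w j) / pop E w j"
    have "(\<Sum>i\<in>UNIV. real (w i) * (?x i * exp (- (\<Sum>j\<in>nbhd E i. ?x j))) - 2 * real V) \<le>
        (\<Sum>i\<in>UNIV. real (w i) * service_rate E w i)"
      using service_rate_ge[OF sym, where w = w] by (intro sum_mono) (simp add: V)
    with proportional_fairness[OF sym V, of w] show ?thesis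
      by (simp add: sum_subtractf algebra_simps)
  qed
  \<comment> \<open>The coefficient is nonpositive, so the sum may be replaced by the smaller
    norm.\<close>
  also have "\<dots> \<le> (lam - exp (- 1) / real V) * enorm w + 2 * real V * real CARD('v)"
    using lam enorm_le_sum[of w] by (intro add_right_mono mult_left_mono_neg) auto
  finally have "measure_pmf.expectation ?p ?s / enorm w \<le>
      ((lam - exp (- 1) / real V) * enorm w + 2 * real V * real CARD('v)) / enorm w"
    using pos by (intro divide_right_mono) auto
  also have "\<dots> = (lam - exp (- 1) / real V) + 2 * real V * real CARD('v) / enorm w"
    using pos by (simp add: add_divide_distrib)
  also have "2 * real V * real CARD('v) / enorm w \<le> 2 * real V * real CARD('v) / R"
    using R pos by (intro divide_left_mono) auto
  finally have exp_s: "measure_pmf.expectation ?p ?s / enorm w \<le>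
      lam - exp (- 1) / real V + 2 * real V * real CARD('v) / R"
    by simp

  have "measure_pmf.expectation (queue_kernel E \<alpha> w) enorm =
      measure_pmf.expectation ?p (\<lambda>z. enorm (\<lambda>i. w i + snd z i - departures E (fst z) i))"
    by (simp add: queue_kernel_eq_map_pmf)
  also have "\<dots> \<le> measure_pmf.expectation ?p (\<lambda>z. enorm w + ?s z / enorm w + ?e (snd z))"
  proof (rule integral_mono)
    show "integrable (measure_pmf ?p) (\<lambda>z. enorm (\<lambda>i. w i + snd z i - departures E (fst z) i))"
      using integrable_enorm_queue_kernel[OF int, of E w] by (simp add: queue_kernel_eq_map_pmf)
    show "integrable (measure_pmf ?p) (\<lambda>z. enorm w + ?s z / enorm w + ?e (snd z))"
      by (intro Bochner_Integration.integrable_add measure_pmf.integrable_const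
          integrable_divide int_s int_e)
    show "enorm (\<lambda>i. w i + snd z i - departures E (fst z) i) \<le> enorm w + ?s z / enorm w + ?e (snd z)" for z
      unfolding b_def by (rule enorm_step_drift[OF sum_departures_le R])
  qed
  also have "\<dots> = enorm w + measure_pmf.expectation ?p ?s / enorm w + measure_pmf.expectation ?p (\<lambda>z. ?e (snd z))"
  proof -
    have 1: "integrable (measure_pmf ?p) (\<lambda>z. ?s z / enorm w)"
      by (rule integrable_divide[OF int_s])
    have 2: "integrable (measure_pmf ?p) (\<lambda>z. enorm w + ?s z / enorm w)"
      by (rule Bochner_Integration.integrable_add[OF measure_pmf.integrable_const 1])
    show ?thesis
      unfolding Bochner_Integration.integral_add[OF 2 int_e]
        Bochner_Integration.integral_add[OF measure_pmf.integrable_const 1]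
      by simp
  qed
  also have "measure_pmf.expectation ?p (\<lambda>z. ?e (snd z)) = measure_pmf.expectation \<alpha> ?e"
    by (rule expectation_pair_pmf_snd)
  finally show ?thesis
    using exp_s by linarith
qed

section \<open>Recurrence and ergodicity of the queue chain\<close>

lemma summable_avoid_prob_queue_kernel:
  fixes E :: "'v::finite rel" and \<alpha> :: "('v \<Rightarrow> nat) pmf"
  assumes sym: "sym E" and int: "\<And>i. integrable (measure_pmf \<alpha>) (\<lambda>a. real (a i))"
    and mean: "\<And>i. measure_pmf.expectation \<alpha> (\<lambda>a. real (a i)) = lam"
    and V: "\<And>i. card (nbhd E i) = V"
    and irr: "irreducible_chain (queue_kernel E \<alpha>)" and lam: "lam < exp (- 1) / real V"
  shows "summable (\<lambda>n. avoid_prob (queue_kernel E \<alpha>) x n y)"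
proof -
  define b where "b a = (\<Sum>i\<in>UNIV. real (a i)) + real CARD('v)" for a :: "'v \<Rightarrow> nat"
  \<comment> \<open>Half of the gap; the other half absorbs the error \<open>c n\<close> for a
    suitable radius \<open>Suc n\<close>.\<close>
  define \<epsilon> where "\<epsilon> = (exp (- 1) / real V - lam) / 2"
  define c where "c n = 2 * real V * real CARD('v) / real (Suc n) +
      measure_pmf.expectation \<alpha> (\<lambda>a. min (2 * b a) ((b a)\<^sup>2 / (2 * real (Suc n))))" for n
  have "\<epsilon> > 0"
    using lam by (simp add: \<epsilon>_def)
  have int_b: "integrable (measure_pmf \<alpha>) b"
    unfolding b_def by (intro Bochner_Integration.integrable_add
        Bochner_Integration.integrable_sum int measure_pmf.integrable_const)
  have "(\<lambda>n. 2 * real V * real CARD('v) * inverse (real (Suc n))) \<longlonglongrightarrow> 0"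
    by (intro tendsto_mult_right_zero LIMSEQ_inverse_real_of_nat)
  moreover have "0 \<le> b a" for a
    by (simp add: b_def sum_nonneg add_nonneg_nonneg)
  note truncated_square_expectation_tendsto_0[OF int_b this]
  ultimately have "c \<longlonglongrightarrow> 0 + 0"
    unfolding c_def divide_inverse[of "2 * real V * real CARD('v)"] by (rule tendsto_add)
  then have "\<forall>\<^sub>F n in sequentially. c n < \<epsilon>"
    using \<open>\<epsilon> > 0\<close> by (intro order_tendstoD) auto
  then obtain n where n: "c n < \<epsilon>"
    by (auto simp: eventually_sequentially)
  show ?thesis
  proof (rule foster_summable_avoid_prob[OF irr finite_enorm_le \<open>\<epsilon> > 0\<close>])
    fix w :: "'v \<Rightarrow> nat"
    assume "w \<notin> {w. enorm w < real (Suc n)}"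
    then have "real (Suc n) \<le> enorm w"
      by simp
    moreover have "0 < real (Suc n)" "2 * \<epsilon> = exp (- 1) / real V - lam"
      by (simp_all add: \<epsilon>_def)
    ultimately have "measure_pmf.expectation (queue_kernel E \<alpha> w) enorm \<le> enorm w - 2 * \<epsilon> + c n"
      using enorm_drift[OF sym int mean V _ _ less_imp_le[OF lam], of "real (Suc n)" w]
      unfolding c_def b_def by linarith
    with n show "measure_pmf.expectation (queue_kernel E \<alpha> w) enorm \<le> enorm w - \<epsilon>"
      by simp
  qed (auto intro: integrable_enorm_queue_kernel int)
qed

lemma queue_kernel_empty_loop:
  fixes E :: "'v::finite rel"
  assumes "measure_pmf.prob \<alpha> {a. \<forall>i. a i = 0} > 0"
  shows "0 < pmf (queue_kernel E \<alpha> (\<lambda>_. 0)) (\<lambda>_. 0)"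
proof -
  have "{a :: 'v \<Rightarrow> nat. \<forall>i. a i = 0} = {\<lambda>_. 0}"
    by auto
  with assms have "(\<lambda>_. 0) \<in> set_pmf \<alpha>"
    by (simp add: measure_pmf_single pmf_positive_iff)
  \<comment> \<open>Any attempt vector in the support will do, since natural subtraction from zero
    gives zero.\<close>
  moreover obtain m where "m \<in> set_pmf (attempts E (\<lambda>_. 0))"
    using set_pmf_not_empty by fast
  ultimately show ?thesis
    unfolding pmf_positive_iff queue_kernel_def set_bind_pmf set_map_pmf
    by (intro UN_I image_eqI[of _ _ "\<lambda>_. 0"]) auto
qed

theorem theorem1:
  fixes E :: "'v::finite rel"
    and \<alpha> :: "('v \<Rightarrow> nat) pmf"
    and lam :: real
    and V :: nat
  assumes "connected_graph E"
    and "lam > 0"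
    and "\<And>i. integrable (measure_pmf \<alpha>) (\<lambda>a. real (a i))"
    and "\<And>i. measure_pmf.expectation \<alpha> (\<lambda>a. real (a i)) = lam"
    and "\<And>i. card (nbhd E i) = V"
    and "irreducible_chain (queue_kernel E \<alpha>)"
  shows "(lam < exp (-1) / real V \<longrightarrow> positive_recurrent_chain (queue_kernel E \<alpha>)) \<and>
         (lam < exp (-1) / real V \<and> measure_pmf.prob \<alpha> {a. \<forall>i. a i = 0} > 0 \<longrightarrow>
            ergodic_chain (queue_kernel E \<alpha>))"
proof -
  have "sym E"
    using assms(1) by (simp add: connected_graph_def)
  note sm = summable_avoid_prob_queue_kernel[OF this assms(3-6)]
  show ?thesis
    unfolding positive_recurrent_chain_def
    by (intro conjI impI allI; (elim conjE)?)
      (auto intro: positive_recurrent_stateI[OF sm]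
        ergodic_chain_if_self_loop[OF assms(6) sm queue_kernel_empty_loop])
qed

end
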